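(* Let $m\in\mathbb{R}$, $A\in\mathbb{C}^{2\times2}$, and $v\in L^1(\mathbb{R};\mathbb{R})\cap L^2(\mathbb{R};\mathbb{R})$ with $\int_{\mathbb{R}}v=1$. Let $z$ be in the resolvent set of $D_A$. Then for all sufficiently small $\varepsilon>0$, $z$ is in the resolvent set of $D_A^\varepsilon$, and $$\lim_{\varepsilon\to0}\big\|(D_A^\varepsilon-z)^{-1}-(D_A-z)^{-1}\big\|=0$$ in operator norm on $L^2(\mathbb{R};\mathbb{C}^2)$.
   Context: Let $\sigma_1=\begin{pmatrix}0&1\\1&0\end{pmatrix}$, $\sigma_3=\begin{pmatrix}1&0\\0&-1\end{pmatrix}$. Identify $L^2(\mathbb{R};\mathbb{C}^2)=L^2(\mathbb{R}_-;\mathbb{C}^2)\oplus L^2(\mathbb{R}_+;\mathbb{C}^2)$; for $\psi=\psi_-\oplus\psi_+\in H^1(\mathbb{R}_-;\mathbb{C}^2)\oplus H^1(\mathbb{R}_+;\mathbb{C}^2)$, $\psi(0_\pm)$ are the one-sided traces at $0$. Let $\mathscr{D}=-i\sigma_1\frac{d}{dx}+m\sigma_3$, and let $D_A$ be the operator with domain $\{\psi\in H^1(\mathbb{R}_-;\mathbb{C}^2)\oplus H^1(\mathbb{R}_+;\mathbb{C}^2) : (2i\sigma_1-A)\psi(0_+)=(2i\sigma_1+A)\psi(0_-)\}$ acting as $D_A\psi=\mathscr{D}\psi_-\oplus\mathscr{D}\psi_+$; $D_0$ is the free Dirac operator $\mathscr{D}$ on $H^1(\mathbb{R};\mathbb{C}^2)$.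 For $\varepsilon>0$ set $v_\varepsilon(x)=\varepsilon^{-1}v(x/\varepsilon)$ and let $D^\varepsilon_A$ be the operator with domain $H^1(\mathbb{R};\mathbb{C}^2)$ acting by $(D^\varepsilon_A\psi)(x)=(D_0\psi)(x)+A\Big(\int_{\mathbb{R}}v_\varepsilon(y)\psi(y)\,dy\Big)v_\varepsilon(x)$ (i.e. $D_0+A\otimes|v_\varepsilon\rangle\langle v_\varepsilon|$). *)

theory Defs
  imports "HOL-Analysis.Analysis"
begin

type_synonym cvec = "complex ^ 2"
type_synonym cfun = "real \<Rightarrow> cvec"

definition sigma1 :: "complex ^ 2 ^ 2" where
  "sigma1 = (\<chi> i j. if i = j then 0 else 1)"
definition sigma3 :: "complex ^ 2 ^ 2" where
  "sigma3 = (\<chi> i j. if i = j then (if i = 1 then 1 else -1) else 0)"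

definition L2 :: "cfun \<Rightarrow> bool" where
  "L2 f \<longleftrightarrow> f \<in> borel_measurable lborel \<and> integrable lborel (\<lambda>x. (norm (f x))\<^sup>2)"

definition l2norm :: "cfun \<Rightarrow> real" where
  "l2norm f = sqrt (LINT x|lborel. (norm (f x))\<^sup>2)"

text \<open>Action of the differential expression -i sigma_1 d/dx + m sigma_3, given a
  representative u and its (weak, a.e.) derivative g.\<close>
definition dirac_expr :: "real \<Rightarrow> cfun \<Rightarrow> cfun \<Rightarrow> cfun" where
  "dirac_expr m u g x = (- \<i>) *s (sigma1 *v g x) + (complex_of_real m) *s (sigma3 *v u x)"

text \<open>Operators on L^2 are represented by their graphs: T psi phi means psi is in the
  domain and T psi = phi (as a.e.-classes).
  H^1 on an interval is rendered by an absolutely continuous representative u with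
  L^2 derivative g (u(b) - u(a) = integral of g over [a,b]); the one-sided traces
  at 0 are tl = psi(0-) and tr = psi(0+).\<close>
definition D_A :: "real \<Rightarrow> complex ^ 2 ^ 2 \<Rightarrow> cfun \<Rightarrow> cfun \<Rightarrow> bool" where
  "D_A m A \<psi> \<phi> \<longleftrightarrow> L2 \<psi> \<and> L2 \<phi> \<and>
     (\<exists>u g tl tr. (AE x in lborel. \<psi> x = u x) \<and> L2 g \<and>
        (\<forall>b>0. (g has_integral (u b - tr)) {0..b}) \<and>
        (\<forall>a<0. (g has_integral (tl - u a)) {a..0}) \<and>
        (mat (2 * \<i>) ** sigma1 - A) *v tr = (mat (2 * \<i>) ** sigma1 + A) *v tl \<and>
        (AE x in lborel. \<phi> x = dirac_expr m u g x))"

definition v_eps :: "(real \<Rightarrow> real) \<Rightarrow> real \<Rightarrow> real \<Rightarrow> real" where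
  "v_eps v \<epsilon> x = v (x / \<epsilon>) / \<epsilon>"

text \<open>D_0 + A |v_eps><v_eps| with domain H^1(R;C^2).\<close>
definition D_A_eps :: "real \<Rightarrow> complex ^ 2 ^ 2 \<Rightarrow> (real \<Rightarrow> real) \<Rightarrow> real \<Rightarrow> cfun \<Rightarrow> cfun \<Rightarrow> bool" where
  "D_A_eps m A v \<epsilon> \<psi> \<phi> \<longleftrightarrow> L2 \<psi> \<and> L2 \<phi> \<and>
     (\<exists>u g. (AE x in lborel. \<psi> x = u x) \<and> L2 g \<and>
        (\<forall>a b. a \<le> b \<longrightarrow> (g has_integral (u b - u a)) {a..b}) \<and>
        (AE x in lborel. \<phi> x = dirac_expr m u g x +
            (v_eps v \<epsilon> x) *\<^sub>R (A *v (integral\<^sup>L lborel (\<lambda>y. v_eps v \<epsilon> y *\<^sub>R \<psi> y)))))"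

definition is_resolvent :: "(cfun \<Rightarrow> cfun \<Rightarrow> bool) \<Rightarrow> complex \<Rightarrow> (cfun \<Rightarrow> cfun) \<Rightarrow> bool" where
  "is_resolvent T z R \<longleftrightarrow>
     (\<forall>f. L2 f \<longrightarrow> L2 (R f) \<and> T (R f) (\<lambda>x. f x + z *s R f x)) \<and>
     (\<forall>\<psi> \<phi>. T \<psi> \<phi> \<longrightarrow> (AE x in lborel. R (\<lambda>y. \<phi> y - z *s \<psi> y) x = \<psi> x)) \<and>
     (\<exists>C. \<forall>f. L2 f \<longrightarrow> l2norm (R f) \<le> C * l2norm f)"

definition resolvent_set_mem :: "(cfun \<Rightarrow> cfun \<Rightarrow> bool) \<Rightarrow> complex \<Rightarrow> bool" where
  "resolvent_set_mem T z \<longleftrightarrow> (\<exists>R. is_resolvent T z R)"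

definition l2_opnorm_le :: "(cfun \<Rightarrow> cfun) \<Rightarrow> real \<Rightarrow> bool" where
  "l2_opnorm_le S c \<longleftrightarrow> (\<forall>f. L2 f \<longrightarrow> l2norm (S f) \<le> c * l2norm f)"

end

theory Submission
  imports Defs
begin

text \<open>The regularised operator is compared directly with \<open>D_A\<close>. Write \<open>J = \<i> \<sigma>\<^sub>1\<close>,
  \<open>p = v_eps v \<epsilon>\<close> and \<open>q = \<integral> p u\<close>. If \<open>u\<close> solves the regularised equation with right-hand side
  \<open>f\<close>, then \<open>u - w b - chi s\<close> solves the equation for \<open>D_A\<close>, with \<open>f\<close> changed by \<open>O(\<parallel>w\<parallel> \<bar>b\<bar> + \<bar>s\<bar>)\<close>. Here \<open>b = - J A q\<close>, and
  \<open>w = p * E - E\<close> (with \<open>E\<close> the fundamental solution of \<open>d/dx + 1\<close>) absorbs the singular source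
  \<open>p A q\<close>, is small in \<open>L2\<close> and jumps at 0; \<open>chi s\<close> is an \<open>H1\<close> function away from 0 repairing the
  boundary condition. That \<open>s\<close> is small means that \<open>q\<close> is asymptotically the mean of the two
  traces; this holds because the antisymmetric part of \<open>E\<close> integrates to 0 against \<open>p \<otimes> p\<close>.
  The boundedness of \<open>(D_A - z)\<^sup>-\<^sup>1\<close> then gives the norm estimate and hence uniqueness;
  existence reduces to a square linear system, for which uniqueness suffices.\<close>

section \<open>Square-integrable spinors and traces\<close>

text \<open>The obstacle is that the L2 norm of \<open>v_eps v \<epsilon>\<close> blows up as
  \<epsilon> tends to 0, so the finite-rank term is not a small perturbation; only the L1 norm of
  the profile is scale invariant. Square integrability of \<open>p\<close> is therefore used
  qualitatively, and every quantitative bound is stated in terms of \<open>mass\<close> (the L1 norm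
  of \<open>p\<close>) and \<open>spread\<close> (the mean of min 1 (sqrt |x|) against |p|).
  Moreover \<open>u\<close> varies by an amount of order \<open>b\<close> on the very scale of
  \<open>p\<close>, so \<open>q\<close> is close neither to \<open>u 0\<close> nor to one of the
  traces. The source and the pairing carry the same profile \<open>p\<close>; this double occurrence
  makes the odd part of the kernel cancel exactly, and it is the reason why \<open>A\<close> is not
  renormalised in the limit.

  As \<open>A\<close> is an arbitrary matrix, \<open>D_A\<close> need not be self-adjoint. The
  hypothesis on \<open>z\<close> enters only through solvability for \<open>D_A\<close> and an a
  priori bound \<open>C\<close>; no Green function is computed.\<close>

lemma L2_measurable [measurable_dest]: "L2 f \<Longrightarrow> f \<in> borel_measurable borel"
  by (simp add: L2_def)

lemma L2_integrable: "L2 f \<Longrightarrow> integrable lborel (\<lambda>x. (norm (f x))\<^sup>2)"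
  by (simp add: L2_def)

lemma l2norm_nonneg [simp]: "0 \<le> l2norm f"
  by (simp add: l2norm_def)

lemma l2norm_sq: "(l2norm f)\<^sup>2 = (LINT x|lborel. (norm (f x))\<^sup>2)"
  by (simp add: l2norm_def)

lemma L2_dominated:
  assumes f: "f \<in> borel_measurable borel" and g: "integrable lborel g"
    and le: "AE x in lborel. (norm (f x))\<^sup>2 \<le> g x"
  shows "L2 f" "(l2norm f)\<^sup>2 \<le> integral\<^sup>L lborel g"
proof -
  have i: "integrable lborel (\<lambda>x. (norm (f x))\<^sup>2)"
    by (rule Bochner_Integration.integrable_bound[OF g]) (use f le in \<open>auto elim: eventually_mono\<close>)
  then show "L2 f" using f by (simp add: L2_def)
  show "(l2norm f)\<^sup>2 \<le> integral\<^sup>L lborel g"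
    unfolding l2norm_sq by (rule integral_mono_AE[OF i g le])
qed

lemma L2_scale_bound:
  assumes f: "f \<in> borel_measurable borel" and g: "L2 g" and K: "0 \<le> K"
    and le: "AE x in lborel. norm (f x) \<le> K * norm (g x)"
  shows "L2 f" "l2norm f \<le> K * l2norm g"
proof -
  have sq: "AE x in lborel. (norm (f x))\<^sup>2 \<le> K\<^sup>2 * (norm (g x))\<^sup>2"
    using le by eventually_elim (metis norm_ge_zero power_mono power_mult_distrib)
  note d = L2_dominated[OF f _ sq]
  show "L2 f" using d L2_integrable[OF g] by simp
  have "(l2norm f)\<^sup>2 \<le> (K * l2norm g)\<^sup>2"
    using d(2) L2_integrable[OF g] by (simp add: power_mult_distrib l2norm_sq)
  then show "l2norm f \<le> K * l2norm g"
    by (rule power2_le_imp_le) (simp add: K)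
qed

lemma L2_cong_AE:
  assumes "L2 f" "g \<in> borel_measurable borel" "AE x in lborel. f x = g x"
  shows "L2 g"
  by (rule L2_scale_bound(1)[of g f 1]) (use assms in \<open>auto elim: eventually_mono\<close>)

lemma l2norm_cong_AE:
  assumes "f \<in> borel_measurable borel" "g \<in> borel_measurable borel" "AE x in lborel. f x = g x"
  shows "l2norm f = l2norm g"
  unfolding l2norm_def
  by (rule arg_cong[where f = sqrt], rule integral_cong_AE)
     (use assms in \<open>auto elim: eventually_mono\<close>)

lemma L2_zero [simp]: "L2 (\<lambda>x. 0)"
  by (simp add: L2_def)

lemma l2norm_zero [simp]: "l2norm (\<lambda>x. 0) = 0"
  by (simp add: l2norm_def)

lemma l2norm_eq_0_AE:
  assumes "L2 f" "l2norm f \<le> 0"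
  shows "AE x in lborel. f x = 0"
proof -
  have "(LINT x|lborel. (norm (f x))\<^sup>2) = 0"
    using assms(2) l2norm_nonneg[of f] l2norm_sq[of f] by auto
  then show ?thesis
    using integral_nonneg_eq_0_iff_AE[OF L2_integrable[OF assms(1)]] by auto
qed

text \<open>The weight is free because for positive \<open>a\<close>, \<open>b\<close> the choice
  \<open>t = b / a\<close> gives equality; integrated with \<open>t\<close> the ratio of the two
  norms, this yields Minkowski's inequality in \<open>L2_add\<close>.\<close>

lemma sum_sq_le_weighted:
  fixes a b t :: real assumes "0 < t"
  shows "(a + b)\<^sup>2 \<le> (1 + t) * a\<^sup>2 + (1 + 1 / t) * b\<^sup>2"
proof -
  have "(1 + t) * a\<^sup>2 + (1 + 1 / t) * b\<^sup>2 - (a + b)\<^sup>2 = (t * a - b)\<^sup>2 / t"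
    using assms by (simp add: field_simps power2_eq_square)
  moreover have "\<dots> \<ge> 0" using assms by simp
  ultimately show ?thesis by linarith
qed

lemma L2_add:
  assumes f: "L2 f" and g: "L2 g"
  shows "L2 (\<lambda>x. f x + g x)" "l2norm (\<lambda>x. f x + g x) \<le> l2norm f + l2norm g"
proof -
  note [measurable] = L2_measurable[OF f] L2_measurable[OF g]
  have m: "(\<lambda>x. f x + g x) \<in> borel_measurable borel" by measurable
  have le: "(norm (f x + g x))\<^sup>2 \<le> (1 + t) * (norm (f x))\<^sup>2 + (1 + 1 / t) * (norm (g x))\<^sup>2"
    if "0 < t" for x t
    using sum_sq_le_weighted[OF that, of "norm (f x)" "norm (g x)"]
      power_mono[OF norm_triangle_ineq[of "f x" "g x"] norm_ge_zero, of 2] by linarith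
  have i: "integrable lborel (\<lambda>x. (1 + t) * (norm (f x))\<^sup>2 + (1 + 1 / t) * (norm (g x))\<^sup>2)" for t
    using L2_integrable[OF f] L2_integrable[OF g] by simp
  show "L2 (\<lambda>x. f x + g x)"
    by (rule L2_dominated(1)[OF m i[of 1]]) (use le[of 1] in simp)
  have sq: "(l2norm (\<lambda>x. f x + g x))\<^sup>2 \<le> (1 + t) * (l2norm f)\<^sup>2 + (1 + 1 / t) * (l2norm g)\<^sup>2"
    if "0 < t" for t
    using L2_dominated(2)[OF m i[of t]] le[OF that] L2_integrable[OF f] L2_integrable[OF g]
    by (simp add: l2norm_sq)
  show "l2norm (\<lambda>x. f x + g x) \<le> l2norm f + l2norm g"
  proof (cases "l2norm f = 0 \<or> l2norm g = 0")
    case True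
    then show ?thesis
    proof
      assume "l2norm f = 0"
      then have "AE x in lborel. norm (f x + g x) \<le> 1 * norm (g x)"
        using l2norm_eq_0_AE[OF f] by (auto elim: eventually_mono)
      then show ?thesis using L2_scale_bound(2)[OF m g, of 1] \<open>l2norm f = 0\<close> by simp
    next
      assume "l2norm g = 0"
      then have "AE x in lborel. norm (f x + g x) \<le> 1 * norm (f x)"
        using l2norm_eq_0_AE[OF g] by (auto elim: eventually_mono)
      then show ?thesis using L2_scale_bound(2)[OF m f, of 1] \<open>l2norm g = 0\<close> by simp
    qed
  next
    case False
    then have p: "0 < l2norm f" "0 < l2norm g" using l2norm_nonneg[of f] l2norm_nonneg[of g] by linarith+
    have "(l2norm (\<lambda>x. f x + g x))\<^sup>2 \<le> (l2norm f + l2norm g)\<^sup>2"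
    proof -
      have "(1 + b / a) * a\<^sup>2 + (1 + 1 / (b / a)) * b\<^sup>2 = (a + b)\<^sup>2" if "0 < a" "0 < b" for a b :: real
        using that by (simp add: field_simps power2_eq_square)
      then show ?thesis using sq[of "l2norm g / l2norm f"] p by simp
    qed
    then show ?thesis by (rule power2_le_imp_le) (use p in simp)
  qed
qed

lemma L2_linear:
  assumes f: "L2 f" and T: "bounded_linear T" and K: "0 \<le> K" "\<And>y. norm (T y) \<le> K * norm y"
  shows "L2 (\<lambda>x. T (f x))" "l2norm (\<lambda>x. T (f x)) \<le> K * l2norm f"
proof -
  have m: "(\<lambda>x. T (f x)) \<in> borel_measurable borel"
    using measurable_compose[OF L2_measurable[OF f] borel_measurable_continuous_onI[OF linear_continuous_on[OF T]]] .
  show "L2 (\<lambda>x. T (f x))" "l2norm (\<lambda>x. T (f x)) \<le> K * l2norm f"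
    using L2_scale_bound[OF m f K(1)] K(2) by auto
qed

lemma L2_scaleR:
  assumes f: "L2 f"
  shows "L2 (\<lambda>x. c *\<^sub>R f x)" "l2norm (\<lambda>x. c *\<^sub>R f x) \<le> \<bar>c\<bar> * l2norm f"
  using L2_linear[OF f bounded_linear_scaleR_right, of "\<bar>c\<bar>" c] by auto

lemma L2_diff:
  assumes f: "L2 f" and g: "L2 g"
  shows "L2 (\<lambda>x. f x - g x)" "l2norm (\<lambda>x. f x - g x) \<le> l2norm f + l2norm g"
  using L2_add[OF f L2_scaleR(1)[OF g, of "-1"]] L2_scaleR(2)[OF g, of "-1"] by auto

lemma L2_scalar:
  fixes r :: "real \<Rightarrow> real" and c :: cvec
  assumes r: "r \<in> borel_measurable borel" "integrable lborel (\<lambda>x. (r x)\<^sup>2)"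
  shows "L2 (\<lambda>x. r x *\<^sub>R c)" "l2norm (\<lambda>x. r x *\<^sub>R c) = sqrt (LINT x|lborel. (r x)\<^sup>2) * norm c"
proof -
  have e: "(norm (r x *\<^sub>R c))\<^sup>2 = (r x)\<^sup>2 * (norm c)\<^sup>2" for x by (simp add: power_mult_distrib)
  show "L2 (\<lambda>x. r x *\<^sub>R c)" using r unfolding L2_def e by simp
  show "l2norm (\<lambda>x. r x *\<^sub>R c) = sqrt (LINT x|lborel. (r x)\<^sup>2) * norm c"
    unfolding l2norm_def e by (simp add: real_sqrt_mult)
qed

lemma scalar_L2_integrable:
  fixes r :: "real \<Rightarrow> real"
  assumes r: "r \<in> borel_measurable borel" "integrable lborel (\<lambda>x. (r x)\<^sup>2)" and f: "L2 f"
  shows "integrable lborel (\<lambda>x. r x *\<^sub>R f x)"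
proof (rule Bochner_Integration.integrable_bound)
  show "integrable lborel (\<lambda>x. (r x)\<^sup>2 + (norm (f x))\<^sup>2)" using r(2) L2_integrable[OF f] by simp
  note [measurable] = r(1) L2_measurable[OF f]
  show "(\<lambda>x. r x *\<^sub>R f x) \<in> borel_measurable lborel" by measurable
  have "\<bar>a\<bar> * b \<le> a\<^sup>2 + b\<^sup>2" for a b :: real
    using sum_squares_bound[of "\<bar>a\<bar>" b] zero_le_power2[of a] zero_le_power2[of b]
    unfolding power2_abs by linarith
  then show "AE x in lborel. norm (r x *\<^sub>R f x) \<le> norm ((r x)\<^sup>2 + (norm (f x))\<^sup>2)" by simp
qed

lemma integrable_indicator_Icc: "integrable lborel (indicator {a..b::real} :: real \<Rightarrow> real)"
  by (rule integrable_real_indicator) (use emeasure_bounded_finite[of "{a..b}"] in \<open>simp_all add: less_top\<close>)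

lemma L2_integrable_interval:
  assumes "L2 g" shows "integrable lborel (\<lambda>x. indicator {a..b::real} x *\<^sub>R g x)"
  by (rule scalar_L2_integrable[OF _ _ assms]) (simp_all add: power2_eq_square indicator_inter_arith[symmetric] integrable_indicator_Icc)

lemma L2_has_integral_interval:
  assumes "L2 g" shows "(g has_integral (LINT x|lborel. indicator {a..b::real} x *\<^sub>R g x)) {a..b}"
  using has_integral_integral_lborel[OF L2_integrable_interval[OF assms, of a b]]
  by (simp only: indicator_scaleR_eq_if has_integral_restrict_UNIV)

text \<open>Cauchy-Schwarz against the indicator of the interval, obtained by integrating |g| <= (t
  + |g|^2 / t) / 2 and then optimising in \<open>t\<close>.\<close>

lemma L2_integral_interval_bound:
  assumes g: "L2 g" and ab: "a \<le> b" and I: "(g has_integral I) {a..b::real}"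
  shows "norm I \<le> sqrt (b - a) * l2norm g"
proof (cases "a = b")
  case True
  then have "I = 0" using I has_integral_refl(2)[of g a] by (auto intro: has_integral_unique)
  then show ?thesis by (simp add: True)
next
  case False
  then have d: "0 < b - a" using ab by simp
  have I': "I = (LINT x|lborel. indicator {a..b} x *\<^sub>R g x)"
    using has_integral_unique[OF I L2_has_integral_interval[OF g]] .
  have le: "norm I \<le> ((b - a) * t + (l2norm g)\<^sup>2 / t) / 2" if t: "0 < t" for t
  proof -
    have "norm I \<le> (LINT x|lborel. norm (indicator {a..b} x *\<^sub>R g x))"
      unfolding I' by (rule integral_norm_bound)
    also have "\<dots> \<le> (LINT x|lborel. (indicator {a..b} x * t + (norm (g x))\<^sup>2 / t) / 2)"
    proof (rule integral_mono)
      show "integrable lborel (\<lambda>x. norm (indicator {a..b} x *\<^sub>R g x))"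
        using L2_integrable_interval[OF g, of a b] by (rule integrable_norm)
      show "integrable lborel (\<lambda>x. (indicator {a..b} x * t + (norm (g x))\<^sup>2 / t) / 2)"
        using L2_integrable[OF g] integrable_indicator_Icc by simp
      show "norm (indicator {a..b} x *\<^sub>R g x) \<le> (indicator {a..b} x * t + (norm (g x))\<^sup>2 / t) / 2" for x
      proof -
        have "(t - norm (g x))\<^sup>2 / t \<ge> 0" using t by simp
        then have "norm (g x) \<le> (t + (norm (g x))\<^sup>2 / t) / 2"
          using t by (simp add: power2_diff field_simps power2_eq_square)
        then show ?thesis using t by (auto simp: indicator_def)
      qed
    qed
    also have "\<dots> = ((b - a) * t + (l2norm g)\<^sup>2 / t) / 2"
      using L2_integrable[OF g] ab by (simp add: l2norm_sq)
    finally show ?thesis .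
  qed
  have e: "norm I \<le> sqrt (b - a) * l2norm g + e" if "0 < e" for e
  proof -
    define s where "s = sqrt (b - a)"
    have s: "0 < s" "s\<^sup>2 = b - a" using d by (auto simp: s_def)
    \<comment> \<open>The optimal weight is \<open>l2norm g / s\<close>; adding \<open>e / s\<close>
      keeps it positive when \<open>g\<close> vanishes almost everywhere.\<close>
    define n where "n = l2norm g + e / s"
    have n: "0 < n" "l2norm g \<le> n" using that s by (auto simp: n_def intro!: add_nonneg_pos)
    have "norm I \<le> (s\<^sup>2 * (n / s) + (l2norm g)\<^sup>2 / (n / s)) / 2" using le[of "n / s"] n s by simp
    also have "\<dots> = s * (n + (l2norm g)\<^sup>2 / n) / 2" using n s by (simp add: field_simps power2_eq_square)
    also have "\<dots> \<le> s * (n + n) / 2"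
    proof -
      have "(l2norm g)\<^sup>2 \<le> n\<^sup>2" using n by (intro power_mono) auto
      then have "(l2norm g)\<^sup>2 / n \<le> n" using n by (simp add: field_simps power2_eq_square)
      then show ?thesis using s by simp
    qed
    also have "\<dots> = s * l2norm g + e" using s by (simp add: n_def field_simps)
    finally show ?thesis by (simp add: s_def)
  qed
  then show ?thesis by (rule field_le_epsilon)
qed

text \<open>Boundary values are controlled on an interval of freely chosen length \<open>h\<close>;
  letting \<open>h\<close> tend to 0 shows that traces depend only on the a.e. class.\<close>

lemma trace_bound:
  fixes t :: cvec
  assumes u: "L2 u" and h: "0 < h" and G: "0 \<le> G"
    and near: "\<And>x. a < x \<Longrightarrow> x < a + h \<Longrightarrow> norm (u x - t) \<le> sqrt h * G"
  shows "norm t \<le> 2 * (l2norm u / sqrt h + sqrt h * G)"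
proof -
  \<comment> \<open>The left side is constant on an interval of length \<open>h\<close>, so
    integrating turns this pointwise bound into one for \<open>h * (norm t)\<^sup>2\<close>.\<close>
  have pt: "indicator {a<..<a+h} x * (norm t)\<^sup>2 \<le> 2 * (norm (u x))\<^sup>2 + indicator {a<..<a+h} x * (2 * (h * G\<^sup>2))" for x
  proof (cases "x \<in> {a<..<a+h}")
    case True
    have "norm t \<le> norm (u x) + sqrt h * G"
      using near[of x] True norm_triangle_ineq4[of "u x" "u x - t"] by auto
    then have "(norm t)\<^sup>2 \<le> (norm (u x) + sqrt h * G)\<^sup>2" by (intro power_mono) auto
    also have "\<dots> \<le> 2 * (norm (u x))\<^sup>2 + 2 * (sqrt h * G)\<^sup>2"
      using sum_sq_le_weighted[of 1 "norm (u x)" "sqrt h * G"] by simp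
    finally show ?thesis using True h by (simp add: power_mult_distrib)
  qed simp
  have "(LINT x|lborel. indicator {a<..<a+h} x * (norm t)\<^sup>2)
      \<le> (LINT x|lborel. 2 * (norm (u x))\<^sup>2 + indicator {a<..<a+h} x * (2 * (h * G\<^sup>2)))"
    by (rule integral_mono[OF _ _ pt]) (use L2_integrable[OF u] h in simp_all)
  then have "h * (norm t)\<^sup>2 \<le> 2 * (l2norm u)\<^sup>2 + 2 * h * (h * G\<^sup>2)"
    using L2_integrable[OF u] h by (simp add: l2norm_sq)
  then have "(norm t)\<^sup>2 \<le> 2 * (l2norm u / sqrt h)\<^sup>2 + 2 * (sqrt h * G)\<^sup>2"
    using h by (simp add: field_simps power_mult_distrib)
  also have "\<dots> \<le> (2 * (l2norm u / sqrt h + sqrt h * G))\<^sup>2"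
  proof -
    have "2 * x\<^sup>2 + 2 * y\<^sup>2 \<le> (2 * (x + y))\<^sup>2" if "0 \<le> x" "0 \<le> y" for x y :: real
      using that by (simp add: power2_eq_square algebra_simps)
    from this[of "l2norm u / sqrt h" "sqrt h * G"] show ?thesis using h G by simp
  qed
  finally show ?thesis
    by (rule power2_le_imp_le) (use h G in simp)
qed

section \<open>Averaged exponential kernels\<close>

definition heav :: "real \<Rightarrow> real" where
  "heav t = (if 0 \<le> t then 1 else 0)"

text \<open>The value 1 at 0 makes it right-continuous; this convention, shared with
  \<open>heav\<close>, makes \<open>w 0\<close> the right-hand trace of \<open>w\<close>.\<close>

definition ekern :: "real \<Rightarrow> real" where
  "ekern t = (if 0 \<le> t then exp (- t) else 0)"

lemma heav_measurable [measurable]: "heav \<in> borel_measurable borel"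
  unfolding heav_def by measurable

lemma ekern_measurable [measurable]: "ekern \<in> borel_measurable borel"
  unfolding ekern_def by measurable

lemma ekern_nonneg [simp]: "0 \<le> ekern t"
  by (simp add: ekern_def)

lemma ekern_le_1 [simp]: "ekern t \<le> 1"
  by (simp add: ekern_def)

lemma ekern_diff_le_1: "\<bar>ekern s - ekern t\<bar> \<le> 1"
  using ekern_nonneg[of s] ekern_nonneg[of t] ekern_le_1[of s] ekern_le_1[of t] by linarith

text \<open>The antiderivative \<open>heav - ekern\<close> equals max 0 (1 - exp (-t)): the two
  jumps cancel, so the fundamental theorem applies with the kink at \<open>y\<close> as the only
  exceptional point.\<close>

lemma ekern_has_integral:
  assumes "a \<le> b"
  shows "((\<lambda>x. ekern (x - y)) has_integral
    (heav (b - y) - ekern (b - y) - (heav (a - y) - ekern (a - y)))) {a..b}"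
proof (rule fundamental_theorem_of_calculus_interior_strong[where S = "{y}"])
  have eq: "heav t - ekern t = max 0 (1 - exp (- t))" for t :: real
    by (simp add: heav_def ekern_def max_def)
  show "continuous_on {a..b} (\<lambda>x. heav (x - y) - ekern (x - y))"
    unfolding eq by (intro continuous_intros)
  fix x assume x: "x \<in> {a<..<b} - {y}"
  have "((\<lambda>x. heav (x - y) - ekern (x - y)) has_real_derivative ekern (x - y)) (at x)"
  proof (cases "x < y")
    case True
    have "((\<lambda>x. 0) has_real_derivative 0) (at x)" by simp
    then have "((\<lambda>x. heav (x - y) - ekern (x - y)) has_real_derivative 0) (at x)"
      by (rule has_field_derivative_transform_within_open[where S = "{..<y}"])
         (use True in \<open>auto simp: heav_def ekern_def\<close>)
    then show ?thesis using True by (simp add: ekern_def)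
  next
    case False
    then have xy: "y < x" using x by auto
    have "((\<lambda>x. 1 - exp (- (x - y))) has_real_derivative exp (- (x - y))) (at x)"
      by (auto intro!: derivative_eq_intros)
    then have "((\<lambda>x. heav (x - y) - ekern (x - y)) has_real_derivative exp (- (x - y))) (at x)"
      by (rule has_field_derivative_transform_within_open[where S = "{y<..}"])
         (use xy in \<open>auto simp: heav_def ekern_def\<close>)
    then show ?thesis using xy by (simp add: ekern_def)
  qed
  then show "((\<lambda>x. heav (x - y) - ekern (x - y)) has_vector_derivative ekern (x - y)) (at x)"
    by (simp add: has_real_derivative_iff_has_vector_derivative)
qed (use assms in auto)

lemma ekern_has_bochner: "has_bochner_integral lborel ekern 1"
proof (rule has_bochner_integral_nn_integral)
  have "((\<lambda>x::real. exp (- 1 * x)) has_integral exp (- 1 * 0) / 1) {0..}"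
    by (rule has_integral_exp_minus_to_infinity) simp
  then have "((\<lambda>x::real. if x \<in> {0..} then exp (- x) else 0) has_integral 1) UNIV"
    by (subst has_integral_restrict_UNIV) simp
  then have "(ekern has_integral 1) UNIV" by (simp add: ekern_def[abs_def])
  then show "(\<integral>\<^sup>+ x. ennreal (ekern x) \<partial>lborel) = ennreal 1"
    by (intro nn_integral_has_integral_lborel) auto
qed auto

lemma ekern_integrable: "integrable lborel ekern"
  and ekern_integral: "integral\<^sup>L lborel ekern = 1"
  using ekern_has_bochner by (auto simp: has_bochner_integral_iff)

lemma ekern_shift_integrable: "integrable lborel (\<lambda>x. ekern (x - y))"
  using lborel_integrable_real_affine[OF ekern_integrable, of 1 "- y"] by simp

lemma ekern_shift_integral: "(LINT x|lborel. ekern (x - y)) = 1"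
  using lborel_integral_real_affine[of 1 ekern "- y"] ekern_integral by simp

lemma has_integral_indicator_lborel:
  fixes f :: "real \<Rightarrow> real"
  assumes "integrable lborel (\<lambda>x. indicator S x * f x)"
  shows "(f has_integral (LINT x|lborel. indicator S x * f x)) S"
proof -
  have "(\<lambda>x. indicator S x * f x) = (\<lambda>x. if x \<in> S then f x else 0)" by auto
  then show ?thesis
    using has_integral_integral_lborel[OF assms] has_integral_restrict_UNIV[of S f] by simp
qed

text \<open>The modulus of continuity that H1 functions have up to the origin. Without the
  truncation, smallness of its mean against |v_eps| would require a moment of \<open>v\<close>, and
  only integrability is assumed.\<close>

definition trunc_sqrt :: "real \<Rightarrow> real" where
  "trunc_sqrt x = min 1 (sqrt \<bar>x\<bar>)"

lemma trunc_sqrt_measurable [measurable]: "trunc_sqrt \<in> borel_measurable borel"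
  unfolding trunc_sqrt_def by measurable

lemma trunc_sqrt_nonneg [simp]: "0 \<le> trunc_sqrt x"
  by (simp add: trunc_sqrt_def)

lemma trunc_sqrt_le_1 [simp]: "trunc_sqrt x \<le> 1"
  by (simp add: trunc_sqrt_def)

lemma min_le_trunc_sqrt: "min 1 \<bar>x\<bar> \<le> trunc_sqrt x"
proof (cases "\<bar>x\<bar> \<le> 1")
  case True
  have "\<bar>x\<bar> * \<bar>x\<bar> \<le> \<bar>x\<bar> * 1" by (rule mult_left_mono) (use True in auto)
  then have "\<bar>x\<bar> \<le> sqrt \<bar>x\<bar>" by (intro real_le_rsqrt) (simp add: power2_eq_square)
  then show ?thesis by (simp add: trunc_sqrt_def min_def)
qed (auto simp: trunc_sqrt_def)

lemma one_minus_exp_le: "1 - exp (- \<bar>x\<bar>) \<le> trunc_sqrt x"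
  using min_le_trunc_sqrt[of x] exp_ge_add_one_self[of "- \<bar>x\<bar>"] exp_ge_zero[of "- \<bar>x\<bar>"] by linarith

text \<open>For y > 0 the difference is negative only on [0, y), where it equals
  \<open>- ekern x\<close>, and its total integral is 0; hence its L1 norm is twice the integral of
  \<open>ekern\<close> over that interval. Negative \<open>y\<close> reduces to this case by
  translation.\<close>

lemma ekern_translate_L1:
  "(LINT x|lborel. \<bar>ekern (x - y) - ekern x\<bar>) \<le> 2 * trunc_sqrt y"
proof -
  have pos: "(LINT x|lborel. \<bar>ekern (x - y) - ekern x\<bar>) \<le> 2 * min 1 y" if y: "0 \<le> y" for y
  proof -
    have i: "integrable lborel (\<lambda>x. indicator {0..y} x * ekern x)"
      by (rule Bochner_Integration.integrable_bound[OF ekern_integrable]) (auto simp: indicator_def)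
    have "(LINT x|lborel. \<bar>ekern (x - y) - ekern x\<bar>)
        \<le> (LINT x|lborel. 2 * (indicator {0..y} x * ekern x) + (ekern (x - y) - ekern x))"
    proof (rule integral_mono)
      show "\<bar>ekern (x - y) - ekern x\<bar> \<le> 2 * (indicator {0..y} x * ekern x) + (ekern (x - y) - ekern x)" for x
        using y by (auto simp: ekern_def indicator_def)
    qed (use i ekern_integrable ekern_shift_integrable in auto)
    also have "\<dots> = 2 * (LINT x|lborel. indicator {0..y} x * ekern x)"
      using i ekern_integrable ekern_shift_integrable by (simp add: ekern_integral ekern_shift_integral)
    also have "(LINT x|lborel. indicator {0..y} x * ekern x) \<le> min 1 y"
    proof -
      have "(LINT x|lborel. indicator {0..y} x * ekern x) \<le> (LINT x|lborel. ekern x)"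
        by (rule integral_mono[OF i ekern_integrable]) (auto simp: indicator_def)
      moreover have "(LINT x|lborel. indicator {0..y} x * ekern x) \<le> (LINT x|lborel. indicator {0..y} x)"
        by (rule integral_mono[OF i integrable_indicator_Icc]) (auto simp: indicator_def)
      ultimately show ?thesis using y by (simp add: ekern_integral)
    qed
    finally show ?thesis by simp
  qed
  have "(LINT x|lborel. \<bar>ekern (x - y) - ekern x\<bar>) \<le> 2 * min 1 \<bar>y\<bar>"
  proof (cases "0 \<le> y")
    case False
    have "(LINT x|lborel. \<bar>ekern (x - y) - ekern x\<bar>) = (LINT x|lborel. \<bar>ekern (x - (- y)) - ekern x\<bar>)"
      using lborel_integral_real_affine[of 1 "\<lambda>x. \<bar>ekern (x - y) - ekern x\<bar>" y]
      by (simp add: abs_minus_commute add.commute)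
    then show ?thesis using pos[of "- y"] False by simp
  qed (use pos in simp)
  then show ?thesis using min_le_trunc_sqrt[of y] by linarith
qed

section \<open>Averages against an integrable profile of total integral one\<close>

locale mollifier =
  fixes p :: "real \<Rightarrow> real"
  assumes p_measurable [measurable]: "p \<in> borel_measurable borel"
    and p_integrable: "integrable lborel p"
    and p_sq_integrable: "integrable lborel (\<lambda>x. (p x)\<^sup>2)"
    and p_integral: "integral\<^sup>L lborel p = 1"
begin

definition mass :: real where
  "mass = (LINT x|lborel. \<bar>p x\<bar>)"

definition spread :: real where
  "spread = (LINT x|lborel. \<bar>p x\<bar> * trunc_sqrt x)"

text \<open>\<open>w\<close> is \<open>p * E - E\<close> for the fundamental solution \<open>E\<close> of \<open>d/dx + 1\<close>; it is square
  integrable although \<open>p * heav - heav\<close> need not be, and jumps by \<open>-1\<close> at the origin.\<close>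

definition w :: "real \<Rightarrow> real" where
  "w x = (LINT y|lborel. p y * (ekern (x - y) - ekern x))"

lemma p_times_bounded:
  fixes h :: "real \<Rightarrow> 'a::{banach, second_countable_topology}"
  assumes "h \<in> borel_measurable borel" "\<And>x. norm (h x) \<le> B"
  shows "integrable lborel (\<lambda>x. p x *\<^sub>R h x)"
proof (rule Bochner_Integration.integrable_bound)
  show "integrable lborel (\<lambda>x. B * p x)" using p_integrable by simp
  show "(\<lambda>x. p x *\<^sub>R h x) \<in> borel_measurable lborel" using assms(1) by measurable
  have "norm (p x *\<^sub>R h x) \<le> norm (B * p x)" for x
    using mult_right_mono[OF order_trans[OF assms(2) abs_ge_self], of "\<bar>p x\<bar>" x]
    by (simp add: abs_mult mult.commute)
  then show "AE x in lborel. norm (p x *\<^sub>R h x) \<le> norm (B * p x)" by simp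
qed

lemma p_times_bounded_real:
  fixes h :: "real \<Rightarrow> real"
  assumes "h \<in> borel_measurable borel" "\<And>x. \<bar>h x\<bar> \<le> B"
  shows "integrable lborel (\<lambda>x. p x * h x)"
  using p_times_bounded[OF assms(1), of B] assms(2) by simp

lemma abs_p_integrable: "integrable lborel (\<lambda>x. \<bar>p x\<bar>)"
  using p_integrable by (rule integrable_abs)

lemma integral_abs_p_times:
  assumes "h \<in> borel_measurable borel" "\<And>x. \<bar>h x\<bar> \<le> B"
  shows "(LINT x|lborel. \<bar>p x * h x\<bar>) \<le> B * mass"
proof -
  have "(LINT x|lborel. \<bar>p x * h x\<bar>) \<le> (LINT x|lborel. B * \<bar>p x\<bar>)"
  proof (rule integral_mono)
    show "\<bar>p x * h x\<bar> \<le> B * \<bar>p x\<bar>" for x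
      using mult_right_mono[OF assms(2), of "\<bar>p x\<bar>" x] by (simp add: abs_mult mult.commute)
  qed (use p_times_bounded_real[OF assms] abs_p_integrable in \<open>auto intro: integrable_abs\<close>)
  then show ?thesis by (simp add: mass_def)
qed

lemma abs_integral_p_times:
  assumes "h \<in> borel_measurable borel" "\<And>x. \<bar>h x\<bar> \<le> B"
  shows "\<bar>LINT x|lborel. p x * h x\<bar> \<le> B * mass"
  using order_trans[OF integral_norm_bound[of lborel "\<lambda>x. p x * h x", unfolded real_norm_def]
      integral_abs_p_times[OF assms]] .

lemma mass_ge_1: "1 \<le> mass"
  using integral_norm_bound[of lborel p] by (simp add: mass_def p_integral)

lemma spread_integrable: "integrable lborel (\<lambda>x. \<bar>p x\<bar> * trunc_sqrt x)"
  using p_times_bounded_real[of trunc_sqrt 1] integrable_abs[of lborel "\<lambda>x. p x * trunc_sqrt x"]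
  by (simp add: abs_mult)

lemma spread_nonneg: "0 \<le> spread"
  unfolding spread_def by simp

lemma kernel_integrable:
  "integrable (lborel \<Otimes>\<^sub>M lborel) (\<lambda>(y, x). p y * (ekern (x - y) - ekern x))"
proof (rule lborel_pair.Fubini_integrable)
  show "(\<lambda>(y, x). p y * (ekern (x - y) - ekern x)) \<in> borel_measurable (lborel \<Otimes>\<^sub>M lborel)"
    by measurable
  have d: "integrable lborel (\<lambda>x. ekern (x - y) - ekern x)" for y
    using ekern_integrable ekern_shift_integrable by simp
  then show "AE y in lborel. integrable lborel (\<lambda>x. case (y, x) of (y, x) \<Rightarrow> p y * (ekern (x - y) - ekern x))"
    by simp
  have "integrable lborel (\<lambda>y. \<bar>p y\<bar> * (LINT x|lborel. \<bar>ekern (x - y) - ekern x\<bar>))"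
  proof (rule Bochner_Integration.integrable_bound)
    show "integrable lborel (\<lambda>y. 2 * \<bar>p y\<bar>)" using abs_p_integrable by simp
    show "(\<lambda>y. \<bar>p y\<bar> * (LINT x|lborel. \<bar>ekern (x - y) - ekern x\<bar>)) \<in> borel_measurable lborel"
      by measurable
    have "\<bar>p y\<bar> * (LINT x|lborel. \<bar>ekern (x - y) - ekern x\<bar>) \<le> \<bar>p y\<bar> * 2" for y
      using ekern_translate_L1[of y] trunc_sqrt_le_1[of y] by (intro mult_left_mono) linarith+
    then show "AE y in lborel. norm (\<bar>p y\<bar> * (LINT x|lborel. \<bar>ekern (x - y) - ekern x\<bar>)) \<le> norm (2 * \<bar>p y\<bar>)"
      by (simp add: abs_mult mult.commute)
  qed
  then show "integrable lborel (\<lambda>y. LINT x|lborel. norm (case (y, x) of (y, x) \<Rightarrow> p y * (ekern (x - y) - ekern x)))"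
    by (simp add: abs_mult)
qed

lemma w_measurable [measurable]: "w \<in> borel_measurable borel"
  unfolding w_def by measurable

lemma w_bound: "\<bar>w x\<bar> \<le> mass"
  unfolding w_def using abs_integral_p_times[of "\<lambda>y. ekern (x - y) - ekern x" 1] ekern_diff_le_1 by simp

text \<open>Fubini reduces the L1 norm of \<open>w\<close> to the L1 distances between
  \<open>ekern\<close> and its translates, weighted by |p|.\<close>

lemma w_integrable: "integrable lborel w"
  and w_L1: "(LINT x|lborel. \<bar>w x\<bar>) \<le> 2 * spread"
proof -
  let ?k = "\<lambda>y x. p y * (ekern (x - y) - ekern x)"
  have k: "integrable (lborel \<Otimes>\<^sub>M lborel) (case_prod ?k)" by (rule kernel_integrable)
  then have ak: "integrable (lborel \<Otimes>\<^sub>M lborel) (case_prod (\<lambda>y x. \<bar>?k y x\<bar>))"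
    using integrable_abs[OF k] by (simp add: case_prod_unfold)
  show wi: "integrable lborel w"
    using lborel_pair.integrable_snd[OF k] by (simp add: w_def[abs_def])
  have "(LINT x|lborel. \<bar>w x\<bar>) \<le> (LINT x|lborel. LINT y|lborel. \<bar>?k y x\<bar>)"
  proof (rule integral_mono)
    show "integrable lborel (\<lambda>x. LINT y|lborel. \<bar>?k y x\<bar>)"
      using lborel_pair.integrable_snd[OF ak] .
    show "\<bar>w x\<bar> \<le> (LINT y|lborel. \<bar>?k y x\<bar>)" for x
      unfolding w_def using integral_norm_bound[of lborel "\<lambda>y. ?k y x"] by simp
  qed (rule integrable_abs[OF wi])
  also have "\<dots> = (LINT y|lborel. LINT x|lborel. \<bar>?k y x\<bar>)"
    by (rule lborel_pair.Fubini_integral[OF ak])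
  also have "\<dots> \<le> (LINT y|lborel. 2 * (\<bar>p y\<bar> * trunc_sqrt y))"
  proof (rule integral_mono)
    show "integrable lborel (\<lambda>y. LINT x|lborel. \<bar>?k y x\<bar>)"
      using lborel_pair.integrable_fst[OF ak] .
    show "integrable lborel (\<lambda>y. 2 * (\<bar>p y\<bar> * trunc_sqrt y))" using spread_integrable by simp
    show "(LINT x|lborel. \<bar>?k y x\<bar>) \<le> 2 * (\<bar>p y\<bar> * trunc_sqrt y)" for y
      using mult_left_mono[OF ekern_translate_L1[of y], of "\<bar>p y\<bar>"] by (simp add: abs_mult mult_ac)
  qed
  finally show "(LINT x|lborel. \<bar>w x\<bar>) \<le> 2 * spread" by (simp add: spread_def)
qed

text \<open>Interpolation between the sup bound \<open>mass\<close> and the small L1 bound. The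
  square root lost here is the reason why the final rate is \<open>sqrt spread\<close> rather than
  \<open>spread\<close>.\<close>

lemma w_sq_integrable: "integrable lborel (\<lambda>x. (w x)\<^sup>2)"
  and w_L2: "(LINT x|lborel. (w x)\<^sup>2) \<le> 2 * mass * spread"
proof -
  have le: "(w x)\<^sup>2 \<le> mass * \<bar>w x\<bar>" for x
    using mult_right_mono[OF w_bound[of x], of "\<bar>w x\<bar>"] by (simp add: power2_eq_square)
  have i: "integrable lborel (\<lambda>x. mass * \<bar>w x\<bar>)" using w_integrable by simp
  show si: "integrable lborel (\<lambda>x. (w x)\<^sup>2)"
    by (rule Bochner_Integration.integrable_bound[OF i])
       (use le mass_ge_1 in \<open>auto simp: abs_mult intro!: AE_I2\<close>)
  have "(LINT x|lborel. (w x)\<^sup>2) \<le> (LINT x|lborel. mass * \<bar>w x\<bar>)"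
    by (rule integral_mono[OF si i le])
  also have "\<dots> \<le> mass * (2 * spread)"
    using mult_left_mono[OF w_L1, of mass] mass_ge_1 by simp
  finally show "(LINT x|lborel. (w x)\<^sup>2) \<le> 2 * mass * spread" by simp
qed

text \<open>The integrated form of w' = p - w - delta_0: Fubini lets the kernel be integrated
  explicitly in \<open>x\<close> first. The \<open>heav\<close> difference is the contribution of
  the point mass at the origin.\<close>

lemma w_has_integral:
  assumes ab: "a \<le> b"
  shows "((\<lambda>x. p x - w x) has_integral (w b - w a + (heav b - heav a))) {a..b}"
proof -
  let ?k = "\<lambda>y x. p y * (ekern (x - y) - ekern x)"
  let ?I = "indicator {a..b} :: real \<Rightarrow> real"
  have m: "(\<lambda>(y, x). ?I x * ?k y x) \<in> borel_measurable (lborel \<Otimes>\<^sub>M lborel)" by measurable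
  have ik: "integrable (lborel \<Otimes>\<^sub>M lborel) (case_prod (\<lambda>y x. ?I x * ?k y x))"
    by (rule Bochner_Integration.integrable_bound[OF kernel_integrable m])
       (auto simp: indicator_def)
  have inner: "(LINT x|lborel. ?I x * ?k y x)
      = p y * (heav (b - y) - heav (a - y)) - p y * (ekern (b - y) - ekern b)
        + p y * (ekern (a - y) - ekern a) - p y * (heav b - heav a)" for y
  proof -
    have i: "integrable lborel (\<lambda>x. ?I x * (ekern (x - y) - ekern x))"
      by (rule Bochner_Integration.integrable_bound[where f = "\<lambda>x. ekern (x - y) - ekern x"])
         (use ekern_integrable ekern_shift_integrable in \<open>auto simp: indicator_def\<close>)
    have "((\<lambda>x. ekern (x - y) - ekern x) has_integral (LINT x|lborel. ?I x * (ekern (x - y) - ekern x))) {a..b}"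
      by (rule has_integral_indicator_lborel[OF i])
    moreover have "((\<lambda>x. ekern (x - y) - ekern x) has_integral
        (heav (b - y) - ekern (b - y) - (heav (a - y) - ekern (a - y)) - (heav b - ekern b - (heav a - ekern a)))) {a..b}"
      using has_integral_diff[OF ekern_has_integral[OF ab, of y] ekern_has_integral[OF ab, of 0]] by simp
    ultimately have "(LINT x|lborel. ?I x * (ekern (x - y) - ekern x))
       = heav (b - y) - ekern (b - y) - (heav (a - y) - ekern (a - y)) - (heav b - ekern b - (heav a - ekern a))"
      by (rule has_integral_unique)
    moreover have "(LINT x|lborel. ?I x * ?k y x) = p y * (LINT x|lborel. ?I x * (ekern (x - y) - ekern x))"
      by (subst integral_mult_right_zero[symmetric]) (simp add: mult_ac)
    ultimately have "(LINT x|lborel. ?I x * ?k y x) = p y * (heav (b - y) - ekern (b - y)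
        - (heav (a - y) - ekern (a - y)) - (heav b - ekern b - (heav a - ekern a)))" by (simp only:)
    then show ?thesis by (simp only: algebra_simps)
  qed
  have ie: "integrable lborel (\<lambda>y. p y * (ekern (c - y) - ekern c))" for c
    by (rule p_times_bounded_real[where B = 1]) (auto intro: ekern_diff_le_1)
  have ih: "integrable lborel (\<lambda>y. p y * (heav (b - y) - heav (a - y)))"
    by (rule p_times_bounded_real[where B = 1]) (auto simp: heav_def)
  have ip: "integrable lborel (\<lambda>y. ?I y * p y)"
    using p_times_bounded_real[of ?I 1] by (simp add: indicator_def mult.commute)
  have iw: "integrable lborel (\<lambda>x. ?I x * w x)"
    using lborel_pair.integrable_snd[OF ik] by (simp add: w_def[abs_def])
  have "(LINT x|lborel. ?I x * w x) = (LINT x|lborel. LINT y|lborel. ?I x * ?k y x)"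
    by (simp add: w_def)
  also have "\<dots> = (LINT y|lborel. LINT x|lborel. ?I x * ?k y x)"
    by (rule lborel_pair.Fubini_integral[OF ik])
  also have "\<dots> = (LINT y|lborel. p y * (heav (b - y) - heav (a - y))) - w b + w a - (heav b - heav a)"
    unfolding inner w_def using ie[of a] ie[of b] ih p_integrable by (simp add: p_integral)
  \<comment> \<open>The difference of the two \<open>heav\<close> terms is the indicator of a
    half-open interval, which disagrees with that of \<open>{a..b}\<close> only at
    \<open>y = a\<close>.\<close>
  also have "(LINT y|lborel. p y * (heav (b - y) - heav (a - y))) = (LINT y|lborel. ?I y * p y)"
  proof (rule integral_cong_AE)
    have "AE y in lborel. y \<noteq> a" by (rule AE_lborel_singleton)
    then show "AE y in lborel. p y * (heav (b - y) - heav (a - y)) = ?I y * p y"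
      by eventually_elim (use ab in \<open>auto simp: heav_def indicator_def\<close>)
  qed measurable
  finally have "(LINT x|lborel. ?I x * (p x - w x)) = w b - w a + (heav b - heav a)"
    using ip iw by (simp add: right_diff_distrib)
  moreover have "integrable lborel (\<lambda>x. ?I x * (p x - w x))"
    using ip iw by (simp add: right_diff_distrib)
  ultimately show ?thesis
    using has_integral_indicator_lborel[of "{a..b}" "\<lambda>x. p x - w x"] by simp
qed

lemma abs_weighted_integral_le_spread:
  fixes h :: "real \<Rightarrow> real"
  assumes m: "h \<in> borel_measurable borel" and le: "\<And>x. \<bar>h x\<bar> \<le> K * trunc_sqrt x" and K: "0 \<le> K"
  shows "integrable lborel (\<lambda>x. p x * h x)" "\<bar>LINT x|lborel. p x * h x\<bar> \<le> K * spread"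
proof -
  have b: "\<bar>h x\<bar> \<le> K" for x
    using order_trans[OF le[of x] mult_left_mono[OF trunc_sqrt_le_1 K]] by simp
  show i: "integrable lborel (\<lambda>x. p x * h x)" by (rule p_times_bounded_real[OF m b])
  have "\<bar>LINT x|lborel. p x * h x\<bar> \<le> (LINT x|lborel. \<bar>p x * h x\<bar>)"
    using integral_norm_bound[of lborel "\<lambda>x. p x * h x"] by simp
  also have "\<dots> \<le> (LINT x|lborel. K * (\<bar>p x\<bar> * trunc_sqrt x))"
  proof (rule integral_mono)
    show "\<bar>p x * h x\<bar> \<le> K * (\<bar>p x\<bar> * trunc_sqrt x)" for x
      using mult_left_mono[OF le[of x], of "\<bar>p x\<bar>"] by (simp add: abs_mult mult_ac)
  qed (use i spread_integrable in auto)
  finally show "\<bar>LINT x|lborel. p x * h x\<bar> \<le> K * spread" by (simp add: spread_def)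
qed

text \<open>Exchanging the two variables changes the sign of the integrand. Exactness matters: an
  odd kernel such as exp (-|t|) sgn t does not become small when \<open>p\<close>
  concentrates.\<close>

lemma double_odd_integral:
  fixes h :: "real \<Rightarrow> real"
  assumes m [measurable]: "h \<in> borel_measurable borel" and b: "\<And>x. \<bar>h x\<bar> \<le> B"
    and odd: "\<And>x. h (- x) = - h x"
  shows "(LINT x|lborel. p x * (LINT y|lborel. p y * h (x - y))) = 0"
proof -
  let ?k = "\<lambda>x y. p x * (p y * h (x - y))"
  have iy: "integrable lborel (\<lambda>y. p y * h (x - y))" for x
    by (rule p_times_bounded_real) (use b in auto)
  have bd: "(LINT y|lborel. \<bar>p y * h (x - y)\<bar>) \<le> B * mass" for x
    by (rule integral_abs_p_times) (use b in auto)
  have k: "integrable (lborel \<Otimes>\<^sub>M lborel) (case_prod ?k)"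
  proof (rule lborel_pair.Fubini_integrable)
    show "case_prod ?k \<in> borel_measurable (lborel \<Otimes>\<^sub>M lborel)" by measurable
    show "AE x in lborel. integrable lborel (\<lambda>y. case (x, y) of (x, y) \<Rightarrow> ?k x y)" using iy by simp
    have "integrable lborel (\<lambda>x. p x * (LINT y|lborel. \<bar>p y * h (x - y)\<bar>))"
      by (rule p_times_bounded_real[where B = "B * mass"]) (use bd in auto)
    from integrable_abs[OF this]
    show "integrable lborel (\<lambda>x. LINT y|lborel. norm (case (x, y) of (x, y) \<Rightarrow> ?k x y))"
      by (simp add: abs_mult)
  qed
  have "(LINT x|lborel. LINT y|lborel. ?k x y) = (LINT y|lborel. LINT x|lborel. ?k x y)"
    by (rule lborel_pair.Fubini_integral[OF k, symmetric])
  also have "\<dots> = (LINT y|lborel. LINT x|lborel. - ?k y x)"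
  proof -
    have k: "?k x y = - ?k y x" for x y
      using odd[of "y - x"] by simp
    show ?thesis
      by (rule Bochner_Integration.integral_cong[OF refl], rule Bochner_Integration.integral_cong[OF refl], rule k)
  qed
  also have "\<dots> = - (LINT x|lborel. LINT y|lborel. ?k x y)" by simp
  finally show ?thesis by simp
qed

text \<open>In the limit the left-hand side vanishes: \<open>p w\<close> carries the same renormalised value
  at the origin as the mean of the one-sided traces. The exact part comes from the
  antisymmetric half of the kernel, which integrates to 0 against \<open>p \<otimes> p\<close>.\<close>

lemma pairing_w:
  "\<bar>(LINT x|lborel. p x * w x) + 1 / 2 - (LINT x|lborel. p x * indicator {..0} x)\<bar> \<le> 2 * mass * spread"
proof -
  \<comment> \<open>The even and odd halves of \<open>ekern\<close>; their sum agrees with it except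
    at 0. Only the even half is continuous there, so only it can be replaced by its value 1/2 at the
    origin.\<close>
  define S where "S = (\<lambda>t::real. exp (- \<bar>t\<bar>) / 2)"
  define Q where "Q = (\<lambda>t::real. exp (- \<bar>t\<bar>) * sgn t / 2)"
  have [measurable]: "S \<in> borel_measurable borel" "Q \<in> borel_measurable borel"
    unfolding S_def Q_def by measurable
  have Sb: "\<bar>S t\<bar> \<le> 1" and Qb: "\<bar>Q t\<bar> \<le> 1" for t
    by (auto simp: S_def Q_def abs_mult abs_sgn_eq intro: order_trans[of _ "1::real"])
  have iS: "integrable lborel (\<lambda>y. p y * S (x - y))" and iQ: "integrable lborel (\<lambda>y. p y * Q (x - y))"
    and iE: "integrable lborel (\<lambda>y. p y * ekern (x - y))" for x
    by (rule p_times_bounded_real[where B = 1]; use Sb Qb in auto)+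
  have iE0: "integrable lborel (\<lambda>y. p y * ekern y)"
    and iH: "integrable lborel (\<lambda>y. p y * indicator {..0} y)"
    by (rule p_times_bounded_real[where B = 1]; auto simp: indicator_def)+
  define cS where "cS x = (LINT y|lborel. p y * S (x - y))" for x
  define cQ where "cQ x = (LINT y|lborel. p y * Q (x - y))" for x
  have [measurable]: "cS \<in> borel_measurable borel" "cQ \<in> borel_measurable borel"
    unfolding cS_def cQ_def by measurable
  have cSb: "\<bar>cS x\<bar> \<le> mass" and cQb: "\<bar>cQ x\<bar> \<le> mass" for x
    unfolding cS_def cQ_def using abs_integral_p_times[where B = 1] Sb Qb by auto
  have w: "w x = cS x + cQ x - ekern x" for x
  proof -
    have "w x = (LINT y|lborel. p y * ekern (x - y)) - ekern x"
      unfolding w_def right_diff_distrib using iE[of x] p_integrable by (simp add: p_integral)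
    also have "(LINT y|lborel. p y * ekern (x - y)) = (LINT y|lborel. p y * S (x - y) + p y * Q (x - y))"
    proof (rule integral_cong_AE)
      have "AE y in lborel. y \<noteq> x" by (rule AE_lborel_singleton)
      then show "AE y in lborel. p y * ekern (x - y) = p y * S (x - y) + p y * Q (x - y)"
        by eventually_elim (auto simp: ekern_def S_def Q_def sgn_if field_simps)
    qed measurable
    also have "\<dots> = cS x + cQ x" using iS iQ by (simp add: cS_def cQ_def)
    finally show ?thesis .
  qed
  have icS: "integrable lborel (\<lambda>x. p x * cS x)" and icQ: "integrable lborel (\<lambda>x. p x * cQ x)"
    by (rule p_times_bounded_real[where B = mass]; use cSb cQb in auto)+
  have Q0: "(LINT x|lborel. p x * cQ x) = 0"
    unfolding cQ_def by (rule double_odd_integral[where B = 1]) (use Qb in \<open>auto simp: Q_def\<close>)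
  have pw: "(LINT x|lborel. p x * w x) = (LINT x|lborel. p x * cS x) - (LINT x|lborel. p x * ekern x)"
  proof -
    have "p x * w x = p x * cS x + p x * cQ x - p x * ekern x" for x by (simp add: w algebra_simps)
    then show ?thesis using icS icQ iE0 Q0 by simp
  qed
  \<comment> \<open>From exp (-|x|) exp (-|y|) <= exp (-|x - y|). The bound separates the variables,
    so each of the two integrations against |p| produces one factor \<open>spread\<close> or
    \<open>mass\<close>.\<close>
  have tau: "\<bar>S (x - y) - 1 / 2\<bar> \<le> (trunc_sqrt x + trunc_sqrt y) / 2" for x y
  proof -
    have ab: "1 - a * b \<le> (1 - a) + (1 - b)" if "a \<le> 1" "b \<le> 1" for a b :: real
      using mult_nonneg_nonneg[of "1 - a" "1 - b"] that by (simp add: algebra_simps)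
    have "exp (- \<bar>x\<bar>) * exp (- \<bar>y\<bar>) \<le> exp (- \<bar>x - y\<bar>)" by (simp flip: exp_add)
    then have "1 - exp (- \<bar>x - y\<bar>) \<le> 1 - exp (- \<bar>x\<bar>) * exp (- \<bar>y\<bar>)" by simp
    also have "\<dots> \<le> (1 - exp (- \<bar>x\<bar>)) + (1 - exp (- \<bar>y\<bar>))" by (rule ab) auto
    also have "\<dots> \<le> trunc_sqrt x + trunc_sqrt y" using one_minus_exp_le[of x] one_minus_exp_le[of y] by simp
    finally show ?thesis by (simp add: S_def abs_if field_simps)
  qed
  have cS1: "\<bar>cS x - 1 / 2\<bar> \<le> (mass * trunc_sqrt x + spread) / 2" for x
  proof -
    have i: "integrable lborel (\<lambda>y. p y * (S (x - y) - 1 / 2))"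
      unfolding right_diff_distrib using iS p_integrable by simp
    have "cS x - 1 / 2 = (LINT y|lborel. p y * (S (x - y) - 1 / 2))"
      unfolding right_diff_distrib cS_def using iS[of x] p_integrable by (simp add: p_integral)
    then have "\<bar>cS x - 1 / 2\<bar> \<le> (LINT y|lborel. \<bar>p y * (S (x - y) - 1 / 2)\<bar>)"
      using integral_norm_bound[of lborel "\<lambda>y. p y * (S (x - y) - 1 / 2)"] by simp
    also have "\<dots> \<le> (LINT y|lborel. trunc_sqrt x / 2 * \<bar>p y\<bar> + \<bar>p y\<bar> * trunc_sqrt y / 2)"
    proof (rule integral_mono)
      show "\<bar>p y * (S (x - y) - 1 / 2)\<bar> \<le> trunc_sqrt x / 2 * \<bar>p y\<bar> + \<bar>p y\<bar> * trunc_sqrt y / 2" for y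
        using mult_left_mono[OF tau[of x y], of "\<bar>p y\<bar>"]
        unfolding abs_mult by (simp only: distrib_left distrib_right times_divide_eq_left times_divide_eq_right
            add_divide_distrib mult.commute mult.left_commute abs_ge_zero)
    qed (use i abs_p_integrable spread_integrable in auto)
    also have "\<dots> = (mass * trunc_sqrt x + spread) / 2"
      using abs_p_integrable spread_integrable by (simp add: mass_def spread_def field_simps)
    finally show ?thesis .
  qed
  have A: "\<bar>(LINT x|lborel. p x * cS x) - 1 / 2\<bar> \<le> mass * spread"
  proof -
    have i: "integrable lborel (\<lambda>x. p x * (cS x - 1 / 2))"
      unfolding right_diff_distrib using icS p_integrable by simp
    have "(LINT x|lborel. p x * cS x) - 1 / 2 = (LINT x|lborel. p x * (cS x - 1 / 2))"
      unfolding right_diff_distrib using icS p_integrable by (simp add: p_integral)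
    then have "\<bar>(LINT x|lborel. p x * cS x) - 1 / 2\<bar> \<le> (LINT x|lborel. \<bar>p x * (cS x - 1 / 2)\<bar>)"
      using integral_norm_bound[of lborel "\<lambda>x. p x * (cS x - 1 / 2)"] by simp
    also have "\<dots> \<le> (LINT x|lborel. mass / 2 * (\<bar>p x\<bar> * trunc_sqrt x) + spread / 2 * \<bar>p x\<bar>)"
    proof (rule integral_mono)
      show "\<bar>p x * (cS x - 1 / 2)\<bar> \<le> mass / 2 * (\<bar>p x\<bar> * trunc_sqrt x) + spread / 2 * \<bar>p x\<bar>" for x
        using mult_left_mono[OF cS1[of x], of "\<bar>p x\<bar>"]
        unfolding abs_mult by (simp only: distrib_left distrib_right times_divide_eq_left times_divide_eq_right
            add_divide_distrib mult.commute mult.left_commute abs_ge_zero)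
    qed (use i abs_p_integrable spread_integrable in auto)
    also have "\<dots> = mass / 2 * spread + spread / 2 * mass"
      using abs_p_integrable spread_integrable by (simp add: mass_def spread_def)
    finally show ?thesis by simp
  qed
  \<comment> \<open>Away from 0 the combined weight is 1 - exp (-x) on the right half-line and 0 on
    the left one, hence it is bounded by \<open>trunc_sqrt\<close>.\<close>
  have B: "\<bar>1 - (LINT x|lborel. p x * ekern x) - (LINT x|lborel. p x * indicator {..0} x)\<bar> \<le> spread"
  proof -
    let ?h = "\<lambda>x. if 0 < x then 1 - exp (- \<bar>x\<bar>) else 0"
    have "1 - (LINT x|lborel. p x * ekern x) - (LINT x|lborel. p x * indicator {..0} x)
        = (LINT x|lborel. p x - p x * ekern x - p x * indicator {..0} x)"
      using p_integrable iE0 iH by (simp add: p_integral)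
    also have "\<dots> = (LINT x|lborel. p x * ?h x)"
    proof (rule integral_cong_AE)
      have "AE x in lborel. x \<noteq> (0::real)" by (rule AE_lborel_singleton)
      then show "AE x in lborel. p x - p x * ekern x - p x * indicator {..0} x = p x * ?h x"
        by eventually_elim (auto simp: ekern_def indicator_def algebra_simps)
    qed measurable
    also have "\<bar>\<dots>\<bar> \<le> 1 * spread"
    proof (rule abs_weighted_integral_le_spread)
      show "\<bar>?h x\<bar> \<le> 1 * trunc_sqrt x" for x using one_minus_exp_le[of x] by auto
    qed auto
    finally show ?thesis by simp
  qed
  have "spread \<le> mass * spread" using mult_right_mono[OF mass_ge_1 spread_nonneg] by simp
  then show ?thesis using A B unfolding pw by linarith
qed

end

section \<open>Sobolev functions on the broken line\<close>

definition jmap :: "cvec \<Rightarrow> cvec" where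
  "jmap y = \<i> *s (sigma1 *v y)"

definition kmap :: "real \<Rightarrow> complex \<Rightarrow> cvec \<Rightarrow> cvec" where
  "kmap m z y = complex_of_real m *s (sigma3 *v y) - z *s y"

lemma jmap_component: "jmap y $ 1 = \<i> * y $ 2" "jmap y $ 2 = \<i> * y $ 1"
  by (simp_all add: jmap_def sigma1_def matrix_vector_mult_def sum_2)

lemma kmap_component: "kmap m z y $ 1 = (m - z) * y $ 1" "kmap m z y $ 2 = - (m + z) * y $ 2"
  by (simp_all add: kmap_def sigma3_def matrix_vector_mult_def sum_2 algebra_simps)

lemma cvec_eq_iff: "x = y \<longleftrightarrow> x $ 1 = y $ 1 \<and> x $ 2 = (y $ 2 :: complex)" for x y :: cvec
  by (simp add: vec_eq_iff forall_2)

lemma norm_cvec: "norm (y :: cvec) = sqrt ((norm (y $ 1))\<^sup>2 + (norm (y $ 2))\<^sup>2)"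
  by (simp add: norm_vec_def L2_set_def sum_2)

lemma bounded_linear_jmap: "bounded_linear jmap"
  unfolding linear_conv_bounded_linear[symmetric]
  by (rule linearI) (simp_all add: cvec_eq_iff jmap_component algebra_simps)

lemma bounded_linear_kmap: "bounded_linear (kmap m z)"
  unfolding linear_conv_bounded_linear[symmetric]
  by (rule linearI) (simp_all add: cvec_eq_iff kmap_component algebra_simps)

lemma bounded_linear_mat: "bounded_linear (\<lambda>y. A *v y)" for A :: "complex ^ 2 ^ 2"
  by simp

lemmas jmap_linear = bounded_linear.linear[OF bounded_linear_jmap]
lemmas kmap_linear = bounded_linear.linear[OF bounded_linear_kmap]
lemmas mat_linear = bounded_linear.linear[OF bounded_linear_mat]
lemmas jmap_simps = linear_add[OF jmap_linear] linear_diff[OF jmap_linear] linear_cmul[OF jmap_linear]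
  linear_neg[OF jmap_linear]
lemmas kmap_simps = linear_add[OF kmap_linear] linear_diff[OF kmap_linear] linear_cmul[OF kmap_linear]
  linear_neg[OF kmap_linear]
lemmas mat_simps = linear_add[OF mat_linear] linear_diff[OF mat_linear] linear_cmul[OF mat_linear]
  linear_neg[OF mat_linear]

lemma jmap_jmap [simp]: "jmap (jmap y) = - y"
  by (simp add: cvec_eq_iff jmap_component mult.assoc[symmetric])

lemma norm_jmap [simp]: "norm (jmap y) = norm y"
  by (simp add: norm_cvec jmap_component norm_mult add.commute)

lemma norm_kmap: "norm (kmap m z y) \<le> (\<bar>m\<bar> + cmod z) * norm y"
proof -
  have "norm (complex_of_real m *s (sigma3 *v y)) = \<bar>m\<bar> * norm y"
    by (simp add: norm_cvec sigma3_def matrix_vector_mult_def sum_2 norm_mult power_mult_distrib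
        flip: distrib_left) (simp add: real_sqrt_mult)
  moreover have "norm (z *s y) = cmod z * norm y"
    by (simp add: norm_cvec norm_mult power_mult_distrib flip: distrib_left) (simp add: real_sqrt_mult)
  ultimately show ?thesis
    unfolding kmap_def using norm_triangle_ineq4[of "complex_of_real m *s (sigma3 *v y)" "z *s y"]
    by (simp add: distrib_right)
qed

lemma dirac_expr_eq: "dirac_expr m u g x - z *s u x = - jmap (g x) + kmap m z (u x)"
  by (simp add: dirac_expr_def jmap_def kmap_def vec_eq_iff)

text \<open>Jump against mean: \<open>jmap\<close> of the jump is \<open>A\<close> applied to the
  mean of the traces. A source of amplitude \<open>- jmap (A q)\<close> produces exactly this
  condition when \<open>q\<close> is that mean.\<close>

lemma boundary_condition_iff:
  "(mat (2 * \<i>) ** sigma1 - A) *v r = (mat (2 * \<i>) ** sigma1 + A) *v l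
    \<longleftrightarrow> 2 *\<^sub>R jmap (r - l) = A *v (r + l)"
proof -
  have "(mat (2 * \<i>) ** sigma1) *v y = 2 *\<^sub>R jmap y" for y
    by (simp add: cvec_eq_iff jmap_component sigma1_def mat_def matrix_matrix_mult_def
        matrix_vector_mult_def sum_2 scaleR_conv_of_real)
  then show ?thesis
    by (auto simp: matrix_vector_mult_diff_rdistrib matrix_vector_mult_add_rdistrib jmap_simps
        mat_simps scaleR_diff_right algebra_simps)
qed

text \<open>The value \<open>u 0\<close> is not tied to either trace, so the traces are separate
  arguments and \<open>u\<close> may be redefined at 0.\<close>

definition broken_H1 :: "cfun \<Rightarrow> cfun \<Rightarrow> cvec \<Rightarrow> cvec \<Rightarrow> bool" where
  "broken_H1 u g l r \<longleftrightarrow> L2 u \<and> L2 g \<and>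
     (\<forall>b>0. (g has_integral (u b - r)) {0..b}) \<and> (\<forall>a<0. (g has_integral (l - u a)) {a..0})"

lemma broken_H1_add:
  assumes "broken_H1 u g l r" "broken_H1 u' g' l' r'"
  shows "broken_H1 (\<lambda>x. u x + u' x) (\<lambda>x. g x + g' x) (l + l') (r + r')"
  using assms unfolding broken_H1_def
  by (auto intro: L2_add(1) simp: add_diff_add intro!: has_integral_add)

lemma broken_H1_scaleR:
  assumes "broken_H1 u g l r"
  shows "broken_H1 (\<lambda>x. c *\<^sub>R u x) (\<lambda>x. c *\<^sub>R g x) (c *\<^sub>R l) (c *\<^sub>R r)"
  using assms unfolding broken_H1_def
  by (auto intro: L2_scaleR(1) simp: scaleR_diff_right[symmetric] intro!: has_integral_cmul)

lemma broken_H1_diff: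
  assumes "broken_H1 u g l r" "broken_H1 u' g' l' r'"
  shows "broken_H1 (\<lambda>x. u x - u' x) (\<lambda>x. g x - g' x) (l - l') (r - r')"
  using broken_H1_add[OF assms(1) broken_H1_scaleR[OF assms(2), of "-1"]] by simp

lemma broken_H1_increment:
  assumes "broken_H1 u g l r"
  shows "0 < a \<Longrightarrow> a \<le> b \<Longrightarrow> (g has_integral (u b - u a)) {a..b}"
    and "a \<le> b \<Longrightarrow> b < 0 \<Longrightarrow> (g has_integral (u b - u a)) {a..b}"
proof -
  have g: "L2 g" using assms by (simp add: broken_H1_def)
  define I where "I a b = (LINT x|lborel. indicator {a..b} x *\<^sub>R g x)" for a b
  have I: "(g has_integral I a b) {a..b}" for a b unfolding I_def by (rule L2_has_integral_interval[OF g])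
  show "(g has_integral (u b - u a)) {a..b}" if "0 < a" "a \<le> b"
  proof -
    have "(g has_integral (u a - r + I a b)) {0..b}"
      by (rule has_integral_combine[of 0 a b]) (use that I assms in \<open>auto simp: broken_H1_def\<close>)
    moreover have "(g has_integral (u b - r)) {0..b}" using that assms by (auto simp: broken_H1_def)
    ultimately have "u a - r + I a b = u b - r" by (rule has_integral_unique)
    then have "I a b = u b - u a" by (simp add: algebra_simps)
    then show ?thesis using I[of a b] by simp
  qed
  show "(g has_integral (u b - u a)) {a..b}" if "a \<le> b" "b < 0"
  proof -
    have "(g has_integral (I a b + (l - u b))) {a..0}"
      by (rule has_integral_combine[of a b 0]) (use that I assms in \<open>auto simp: broken_H1_def\<close>)
    moreover have "(g has_integral (l - u a)) {a..0}" using that assms by (auto simp: broken_H1_def)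
    ultimately have "I a b + (l - u b) = l - u a" by (rule has_integral_unique)
    then have "I a b = u b - u a" by (simp add: algebra_simps)
    then show ?thesis using I[of a b] by simp
  qed
qed

lemma broken_H1_near:
  assumes "broken_H1 u g l r"
  shows "0 < x \<Longrightarrow> norm (u x - r) \<le> sqrt x * l2norm g"
    and "x < 0 \<Longrightarrow> norm (u x - l) \<le> sqrt (- x) * l2norm g"
proof -
  have g: "L2 g" using assms by (simp add: broken_H1_def)
  show "norm (u x - r) \<le> sqrt x * l2norm g" if "0 < x"
    using L2_integral_interval_bound[OF g, of 0 x] that assms by (auto simp: broken_H1_def)
  show "norm (u x - l) \<le> sqrt (- x) * l2norm g" if "x < 0"
    using L2_integral_interval_bound[OF g, of x 0] that assms
    by (auto simp: broken_H1_def norm_minus_commute)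
qed

lemma broken_H1_trace_scaled:
  assumes B: "broken_H1 u g l r" and h: "0 < h"
  shows "norm r \<le> 2 * (l2norm u / sqrt h + sqrt h * l2norm g)"
    and "norm l \<le> 2 * (l2norm u / sqrt h + sqrt h * l2norm g)"
proof -
  have u: "L2 u" using B by (simp add: broken_H1_def)
  have mono: "sqrt y * l2norm g \<le> sqrt h * l2norm g" if "y \<le> h" for y
    using that by (intro mult_right_mono) auto
  show "norm r \<le> 2 * (l2norm u / sqrt h + sqrt h * l2norm g)"
    by (rule trace_bound[OF u h, where a = 0])
       (auto intro: order_trans[OF broken_H1_near(1)[OF B] mono])
  show "norm l \<le> 2 * (l2norm u / sqrt h + sqrt h * l2norm g)"
    by (rule trace_bound[OF u h, where a = "- h"])
       (auto intro: order_trans[OF broken_H1_near(2)[OF B] mono])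
qed

lemma broken_H1_trace:
  assumes B: "broken_H1 u g l r"
  shows "norm r \<le> 2 * (l2norm u + l2norm g)" "norm l \<le> 2 * (l2norm u + l2norm g)"
  using broken_H1_trace_scaled[OF B, of 1] by auto

lemma broken_H1_zero_trace:
  assumes B: "broken_H1 u g l r" and z: "AE x in lborel. u x = 0"
  shows "r = 0" "l = 0"
proof -
  have u: "L2 u" using B by (simp add: broken_H1_def)
  have n: "l2norm u = 0"
    using l2norm_cong_AE[OF L2_measurable[OF u] _ z] by simp
  have 0: "t = 0" if t: "\<And>h. 0 < h \<Longrightarrow> norm t \<le> 2 * (sqrt h * l2norm g)" for t :: cvec
  proof -
    have "norm t \<le> e" if e: "0 < e" for e
    proof -
      \<comment> \<open>The summand 1 avoids division by zero; the interval length
        \<open>(e / (2 * G))\<^sup>2\<close> is chosen to make the bound at most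
        \<open>e\<close>.\<close>
      define G where "G = l2norm g + 1"
      have G: "0 < G" "l2norm g \<le> G" using l2norm_nonneg[of g] by (auto simp: G_def add_nonneg_pos)
      have "norm t \<le> 2 * (sqrt ((e / (2 * G))\<^sup>2) * l2norm g)"
        by (rule t) (use e G in simp)
      also have "sqrt ((e / (2 * G))\<^sup>2) = e / (2 * G)"
        using e G by (simp only: real_sqrt_abs) simp
      also have "2 * (e / (2 * G) * l2norm g) = e * (l2norm g / G)" by simp
      also have "\<dots> \<le> e * 1"
        using e G by (intro mult_left_mono) (auto simp: field_simps)
      finally show ?thesis by simp
    qed
    then show ?thesis using field_le_epsilon[of "norm t" 0] by simp
  qed
  show "r = 0" "l = 0"
    by (rule 0; use broken_H1_trace_scaled[OF B] n in simp)+
qed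

text \<open>Near the origin this is Cauchy-Schwarz for the derivative. Farther out,
  \<open>u x\<close> and the trace are each at most twice the sum of the two norms, whence the
  factor 4.\<close>

lemma broken_H1_trace_modulus:
  assumes B: "broken_H1 u g l r" and x: "x \<noteq> 0"
  shows "norm (u x - (if 0 < x then r else l)) \<le> 4 * (l2norm u + l2norm g) * trunc_sqrt x"
proof -
  let ?S = "l2norm u + l2norm g"
  have u: "L2 u" and g: "L2 g" using B by (simp_all add: broken_H1_def)
  have S: "l2norm g \<le> ?S" "0 \<le> ?S" by simp_all
  have n: "norm (u x - (if 0 < x then r else l)) \<le> sqrt \<bar>x\<bar> * l2norm g"
    using broken_H1_near[OF B, of x] x by (auto simp: abs_if)
  show ?thesis
  proof (cases "\<bar>x\<bar> \<le> 1")
    case True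
    have "sqrt \<bar>x\<bar> * l2norm g \<le> sqrt \<bar>x\<bar> * (4 * ?S)"
      using S by (intro mult_left_mono) auto
    moreover have "trunc_sqrt x = sqrt \<bar>x\<bar>" using True by (simp add: trunc_sqrt_def min_def)
    ultimately show ?thesis using n by (simp add: mult.commute)
  next
    case False
    have nb: "norm (u x) \<le> 2 * ?S"
    proof -
      have "norm (u x) \<le> 2 * (l2norm u / sqrt 1 + sqrt 1 * l2norm g)"
      proof (rule trace_bound[OF u, where a = x])
        fix y assume y: "x < y" "y < x + 1"
        have "(g has_integral (u y - u x)) {x..y}"
          using broken_H1_increment[OF B, of x y] y False by (cases "0 < x") auto
        from L2_integral_interval_bound[OF g _ this] y
        have "norm (u y - u x) \<le> sqrt (y - x) * l2norm g" by simp
        also have "\<dots> \<le> sqrt 1 * l2norm g" using y by (intro mult_right_mono) auto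
        finally show "norm (u y - u x) \<le> sqrt 1 * l2norm g" .
      qed auto
      then show ?thesis by simp
    qed
    have "norm (u x - (if 0 < x then r else l)) \<le> norm (u x) + norm (if 0 < x then r else l)"
      by (rule norm_triangle_ineq4)
    also have "\<dots> \<le> 4 * ?S" using nb broken_H1_trace[OF B] by auto
    finally show ?thesis using False by (simp add: trunc_sqrt_def min_def)
  qed
qed

text \<open>The representative \<open>u\<close> in \<open>D_A\<close> is only almost everywhere
  equal to a measurable function, which does not make it Borel; rebuilding it from a parametrised
  integral of \<open>g\<close> does.\<close>

lemma borel_measurable_broken:
  assumes g: "L2 g" and R: "\<And>b. 0 < b \<Longrightarrow> (g has_integral (u b - r)) {0..b}"
    and L: "\<And>a. a < 0 \<Longrightarrow> (g has_integral (l - u a)) {a..0}"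
  shows "(u :: cfun) \<in> borel_measurable borel"
proof -
  define P where "P x = (LINT y|lborel. (if 0 \<le> y \<and> y \<le> x then g y else 0) - (if x \<le> y \<and> y \<le> 0 then g y else 0))" for x
  have [measurable]: "g \<in> borel_measurable borel" by (rule L2_measurable[OF g])
  have [measurable]: "P \<in> borel_measurable borel"
    unfolding P_def by measurable
  have eq: "u x = (if 0 < x then r + P x else if x < 0 then l + P x else u 0)" for x
  proof -
    consider "0 < x" | "x < 0" | "x = 0" by linarith
    then show ?thesis
    proof cases
      case 1
      have "P x = (LINT y|lborel. indicator {0..x} y *\<^sub>R g y)" unfolding P_def
        by (rule Bochner_Integration.integral_cong) (use 1 in \<open>auto simp: indicator_def\<close>)
      then show ?thesis
        using has_integral_unique[OF R[OF 1] L2_has_integral_interval[OF g]] 1 by (simp add: algebra_simps)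
    next
      case 2
      have "P x = - (LINT y|lborel. indicator {x..0} y *\<^sub>R g y)" unfolding P_def
        unfolding Bochner_Integration.integral_minus[symmetric]
        by (rule Bochner_Integration.integral_cong) (use 2 in \<open>auto simp: indicator_def\<close>)
      then show ?thesis
        using has_integral_unique[OF L[OF 2] L2_has_integral_interval[OF g]] 2 by (simp add: algebra_simps)
    qed simp
  qed
  have "(\<lambda>x. if 0 < x then r + P x else if x < 0 then l + P x else u 0) \<in> borel_measurable borel"
    by measurable
  then show ?thesis unfolding eq[abs_def, symmetric] .
qed

section \<open>Gluing the two half-lines\<close>

definition is_H1 :: "cfun \<Rightarrow> cfun \<Rightarrow> bool" where
  "is_H1 u g \<longleftrightarrow> L2 u \<and> L2 g \<and> (\<forall>a b. a \<le> b \<longrightarrow> (g has_integral (u b - u a)) {a..b})"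

lemma is_H1_imp_broken_H1: "is_H1 u g \<Longrightarrow> broken_H1 u g (u 0) (u 0)"
  by (auto simp: is_H1_def broken_H1_def)

lemma AE_fun_upd_lborel: "AE x in lborel. (u(y := c)) x = u x" for u :: cfun
  using AE_lborel_singleton[of y] by eventually_elim simp

lemma broken_H1_imp_is_H1:
  assumes B: "broken_H1 u g t t"
  shows "is_H1 (u(0 := t)) g"
proof -
  have u: "L2 u" and g: "L2 g" using B by (simp_all add: broken_H1_def)
  note [measurable] = L2_measurable[OF u]
  have "L2 (u(0 := t))"
  proof (rule L2_cong_AE[OF u])
    show "u(0 := t) \<in> borel_measurable borel" unfolding fun_upd_def by measurable
    show "AE x in lborel. u x = (u(0 := t)) x"
      using AE_fun_upd_lborel[of u 0 t] by eventually_elim (rule sym)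
  qed
  moreover have "(g has_integral ((u(0 := t)) b - (u(0 := t)) a)) {a..b}" if ab: "a \<le> b" for a b
  proof -
    consider "0 < a" | "b < 0" | "a = 0" "b = 0" | "a = 0" "0 < b" | "a < 0" "b = 0" | "a < 0" "0 < b"
      using ab by linarith
    then show ?thesis
    proof cases
      case 6
      have "(g has_integral ((t - u a) + (u b - t))) {a..b}"
        by (rule has_integral_combine[of a 0 b]) (use 6 B in \<open>auto simp: broken_H1_def\<close>)
      then show ?thesis using 6 by (simp add: algebra_simps)
    next
      case 3 then show ?thesis using has_integral_refl(2)[of g 0] by simp
    qed (use ab B broken_H1_increment[OF B, of a b] in \<open>auto simp: broken_H1_def\<close>)
  qed
  ultimately show ?thesis using g by (simp add: is_H1_def)
qed

section \<open>Correctors\<close>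

definition ehat :: "real \<Rightarrow> real" where
  "ehat x = exp (- \<bar>x\<bar>)"

text \<open>Being odd, \<open>chi s\<close> changes the jump by \<open>2 s\<close> and leaves the
  sum of the traces unchanged, so repairing the boundary condition does not move the mean that it
  involves.\<close>

definition chi :: "real \<Rightarrow> real" where
  "chi x = sgn x * ehat x"

lemma ehat_measurable [measurable]: "ehat \<in> borel_measurable borel"
  unfolding ehat_def by measurable

lemma chi_measurable [measurable]: "chi \<in> borel_measurable borel"
  unfolding chi_def by measurable

lemma ehat_sq_le: "(ehat x)\<^sup>2 \<le> ekern (x - 0) + ekern (- x)"
proof -
  have "exp (- \<bar>x\<bar>) * exp (- \<bar>x\<bar>) \<le> exp (- \<bar>x\<bar>) * 1" by (intro mult_left_mono) auto
  then show ?thesis by (auto simp: ehat_def ekern_def power2_eq_square abs_if)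
qed

lemma ekern_sum_has_bochner: "has_bochner_integral lborel (\<lambda>x. ekern (x - 0) + ekern (- x)) 2"
proof -
  have "integrable lborel (\<lambda>x. ekern (- x))"
    using lborel_integrable_real_affine[OF ekern_integrable, of "-1" 0] by simp
  moreover have "(LINT x|lborel. ekern (- x)) = 1"
    using lborel_integral_real_affine[of "-1" ekern 0] ekern_integral by simp
  ultimately show ?thesis
    using ekern_integrable ekern_integral by (simp add: has_bochner_integral_iff)
qed

lemma ehat_sq_integrable: "integrable lborel (\<lambda>x. (ehat x)\<^sup>2)"
  and ehat_L2: "sqrt (LINT x|lborel. (ehat x)\<^sup>2) \<le> 2"
proof -
  have i: "integrable lborel (\<lambda>x. ekern (x - 0) + ekern (- x))"
    and v: "(LINT x|lborel. ekern (x - 0) + ekern (- x)) = 2"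
    using ekern_sum_has_bochner by (auto simp: has_bochner_integral_iff)
  show si: "integrable lborel (\<lambda>x. (ehat x)\<^sup>2)"
    by (rule Bochner_Integration.integrable_bound[OF i])
       (use ehat_sq_le in \<open>auto intro!: AE_I2 order_trans[OF _ abs_ge_self]\<close>)
  have "(LINT x|lborel. (ehat x)\<^sup>2) \<le> 2"
    using integral_mono[OF si i ehat_sq_le] v by simp
  then show "sqrt (LINT x|lborel. (ehat x)\<^sup>2) \<le> 2"
    by (intro real_le_lsqrt) auto
qed

lemma chi_sq_AE: "AE x in lborel. (chi x)\<^sup>2 = (ehat x)\<^sup>2"
  using AE_lborel_singleton[of "0::real"]
  by eventually_elim (auto simp: chi_def power_mult_distrib sgn_if)

lemma chi_sq_integrable: "integrable lborel (\<lambda>x. (chi x)\<^sup>2)"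
  and chi_L2: "sqrt (LINT x|lborel. (chi x)\<^sup>2) \<le> 2"
proof -
  show "integrable lborel (\<lambda>x. (chi x)\<^sup>2)"
    by (subst integrable_cong_AE[OF _ _ chi_sq_AE]) (use ehat_sq_integrable in auto)
  have "(LINT x|lborel. (chi x)\<^sup>2) = (LINT x|lborel. (ehat x)\<^sup>2)"
    by (rule integral_cong_AE[OF _ _ chi_sq_AE]) auto
  then show "sqrt (LINT x|lborel. (chi x)\<^sup>2) \<le> 2" using ehat_L2 by simp
qed

lemma chi_broken_H1: "broken_H1 (\<lambda>x. chi x *\<^sub>R s) (\<lambda>x. (- ehat x) *\<^sub>R s) (- s) s"
proof -
  have R: "((\<lambda>x. - ehat x) has_integral (chi b - 1)) {0..b}" if b: "0 < b" for b
  proof -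
    have "((\<lambda>x. - exp (- x)) has_integral (exp (- b) - exp (- 0))) {0..b}"
    proof (rule fundamental_theorem_of_calculus)
      fix x assume "x \<in> {0..b}"
      have "((\<lambda>x. exp (- x)) has_real_derivative - exp (- x)) (at x within {0..b})"
        by (auto intro!: derivative_eq_intros)
      then show "((\<lambda>x. exp (- x)) has_vector_derivative - exp (- x)) (at x within {0..b})"
        by (simp add: has_real_derivative_iff_has_vector_derivative)
    qed (use b in simp)
    then have "((\<lambda>x. - ehat x) has_integral (exp (- b) - exp (- 0))) {0..b}"
      by (rule has_integral_eq[rotated]) (auto simp: ehat_def)
    then show ?thesis using b by (simp add: chi_def ehat_def)
  qed
  have L: "((\<lambda>x. - ehat x) has_integral (- 1 - chi a)) {a..0}" if a: "a < 0" for a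
  proof -
    have "((\<lambda>x. - exp x) has_integral (- exp 0 - (- exp a))) {a..0}"
    proof (rule fundamental_theorem_of_calculus)
      fix x assume "x \<in> {a..0}"
      have "((\<lambda>x. - exp x) has_real_derivative - exp x) (at x within {a..0})"
        by (auto intro!: derivative_eq_intros)
      then show "((\<lambda>x. - exp x) has_vector_derivative - exp x) (at x within {a..0})"
        by (simp add: has_real_derivative_iff_has_vector_derivative)
    qed (use a in simp)
    then have "((\<lambda>x. - ehat x) has_integral (- exp 0 - (- exp a))) {a..0}"
      by (rule has_integral_eq[rotated]) (auto simp: ehat_def)
    then show ?thesis using a by (simp add: chi_def ehat_def)
  qed
  have "L2 (\<lambda>x. chi x *\<^sub>R s)" by (rule L2_scalar(1)[OF _ chi_sq_integrable]) simp
  moreover have "L2 (\<lambda>x. (- ehat x) *\<^sub>R s)"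
    by (rule L2_scalar(1)) (use ehat_sq_integrable in auto)
  moreover have "((\<lambda>x. (- ehat x) *\<^sub>R s) has_integral (chi b *\<^sub>R s - s)) {0..b}" if "0 < b" for b
    using has_integral_scaleR_left[OF R[OF that], of s] by (simp add: scaleR_diff_left)
  moreover have "((\<lambda>x. (- ehat x) *\<^sub>R s) has_integral (- s - chi a *\<^sub>R s)) {a..0}" if "a < 0" for a
    using has_integral_scaleR_left[OF L[OF that], of s] by (simp add: scaleR_diff_left)
  ultimately show ?thesis by (simp add: broken_H1_def)
qed

text \<open>\<open>dom_A m A z u g l r f\<close>: the function \<open>u\<close> with derivative \<open>g\<close> and traces \<open>l\<close>, \<open>r\<close>
  lies in the domain of \<open>D_A\<close> and \<open>(D_A - z) u = f\<close>; likewise \<open>dom_E\<close> for \<open>D_0 + A |p><p|\<close>.\<close>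

definition dom_A :: "real \<Rightarrow> complex ^ 2 ^ 2 \<Rightarrow> complex \<Rightarrow> cfun \<Rightarrow> cfun \<Rightarrow> cvec \<Rightarrow> cvec \<Rightarrow> cfun \<Rightarrow> bool" where
  "dom_A m A z u g l r f \<longleftrightarrow> broken_H1 u g l r \<and> L2 f \<and>
     2 *\<^sub>R jmap (r - l) = A *v (r + l) \<and> (AE x in lborel. f x = - jmap (g x) + kmap m z (u x))"

definition dom_E :: "real \<Rightarrow> complex ^ 2 ^ 2 \<Rightarrow> complex \<Rightarrow> (real \<Rightarrow> real) \<Rightarrow> cfun \<Rightarrow> cfun \<Rightarrow> cfun \<Rightarrow> bool" where
  "dom_E m A z p u g f \<longleftrightarrow> is_H1 u g \<and> L2 f \<and>
     (AE x in lborel. f x = - jmap (g x) + kmap m z (u x) + p x *\<^sub>R (A *v (LINT y|lborel. p y *\<^sub>R u y)))"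

lemma dom_A_add:
  assumes "dom_A m A z u g l r f" "dom_A m A z u' g' l' r' f'"
  shows "dom_A m A z (\<lambda>x. u x + u' x) (\<lambda>x. g x + g' x) (l + l') (r + r') (\<lambda>x. f x + f' x)"
proof -
  have ae: "AE x in lborel. f x = - jmap (g x) + kmap m z (u x)"
    "AE x in lborel. f' x = - jmap (g' x) + kmap m z (u' x)"
    using assms by (auto simp: dom_A_def)
  have "AE x in lborel. f x + f' x = - jmap (g x + g' x) + kmap m z (u x + u' x)"
    using ae by eventually_elim (simp add: jmap_simps kmap_simps)
  moreover have "2 *\<^sub>R jmap (r + r' - (l + l')) = A *v (r + r' + (l + l'))"
  proof -
    have "2 *\<^sub>R jmap (r + r' - (l + l')) = 2 *\<^sub>R jmap (r - l) + 2 *\<^sub>R jmap (r' - l')"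
      by (simp add: jmap_simps scaleR_right_distrib scaleR_right_diff_distrib)
    also have "\<dots> = A *v (r + l) + A *v (r' + l')" using assms by (simp add: dom_A_def)
    finally show ?thesis by (simp add: mat_simps)
  qed
  ultimately show ?thesis
    using assms by (auto simp: dom_A_def intro: broken_H1_add L2_add)
qed

lemma dom_A_scaleR:
  assumes "dom_A m A z u g l r f"
  shows "dom_A m A z (\<lambda>x. c *\<^sub>R u x) (\<lambda>x. c *\<^sub>R g x) (c *\<^sub>R l) (c *\<^sub>R r) (\<lambda>x. c *\<^sub>R f x)"
proof -
  have ae: "AE x in lborel. f x = - jmap (g x) + kmap m z (u x)" using assms by (simp add: dom_A_def)
  have "AE x in lborel. c *\<^sub>R f x = - jmap (c *\<^sub>R g x) + kmap m z (c *\<^sub>R u x)"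
    using ae by eventually_elim (simp add: jmap_simps kmap_simps scaleR_right_diff_distrib)
  moreover have "2 *\<^sub>R jmap (c *\<^sub>R r - c *\<^sub>R l) = A *v (c *\<^sub>R r + c *\<^sub>R l)"
  proof -
    have "2 *\<^sub>R jmap (c *\<^sub>R r - c *\<^sub>R l) = c *\<^sub>R (2 *\<^sub>R jmap (r - l))"
      unfolding scaleR_diff_right[symmetric] linear_cmul[OF jmap_linear] by simp
    also have "\<dots> = c *\<^sub>R (A *v (r + l))" using assms by (simp add: dom_A_def)
    finally show ?thesis
      unfolding scaleR_add_right[symmetric] linear_cmul[OF mat_linear] .
  qed
  ultimately show ?thesis
    using assms by (auto simp: dom_A_def intro: broken_H1_scaleR L2_scaleR)
qed

lemma dom_A_diff:
  assumes "dom_A m A z u g l r f" "dom_A m A z u' g' l' r' f'"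
  shows "dom_A m A z (\<lambda>x. u x - u' x) (\<lambda>x. g x - g' x) (l - l') (r - r') (\<lambda>x. f x - f' x)"
  using dom_A_add[OF assms(1) dom_A_scaleR[OF assms(2), of "-1"]] by simp

text \<open>Since \<open>jmap\<close> squares to -1, the equation can be solved for \<open>g\<close>
  as \<open>jmap (f - kmap m z u)\<close>. This upgrades the L2 bound on solutions to control of
  their traces.\<close>

lemma dom_A_deriv_bound:
  assumes d: "dom_A m A z u g l r f"
  shows "l2norm g \<le> l2norm f + (\<bar>m\<bar> + cmod z) * l2norm u"
proof -
  have u: "L2 u" and g: "L2 g" and f: "L2 f" using d by (simp_all add: dom_A_def broken_H1_def)
  have ae: "AE x in lborel. f x = - jmap (g x) + kmap m z (u x)" using d by (simp add: dom_A_def)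
  have K: "L2 (\<lambda>x. kmap m z (u x))" "l2norm (\<lambda>x. kmap m z (u x)) \<le> (\<bar>m\<bar> + cmod z) * l2norm u"
    using L2_linear[OF u bounded_linear_kmap _ norm_kmap] by auto
  have J: "L2 (\<lambda>x. jmap (f x - kmap m z (u x)))"
    "l2norm (\<lambda>x. jmap (f x - kmap m z (u x))) \<le> l2norm (\<lambda>x. f x - kmap m z (u x))"
    using L2_linear[OF L2_diff(1)[OF f K(1)] bounded_linear_jmap, of 1] by auto
  have "AE x in lborel. g x = jmap (f x - kmap m z (u x))"
    using ae by eventually_elim (simp add: jmap_simps)
  then have "l2norm g = l2norm (\<lambda>x. jmap (f x - kmap m z (u x)))"
    by (rule l2norm_cong_AE[OF L2_measurable[OF g] L2_measurable[OF J(1)]])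
  then show ?thesis using J(2) K(2) L2_diff(2)[OF f K(1)] by linarith
qed

section \<open>The corrector attached to the profile \<open>p\<close>\<close>

context mollifier
begin

lemma w_broken_H1: "broken_H1 (\<lambda>x. w x *\<^sub>R b) (\<lambda>x. (p x - w x) *\<^sub>R b) ((w 0 + 1) *\<^sub>R b) (w 0 *\<^sub>R b)"
proof -
  have "integrable lborel (\<lambda>x. (p x - w x)\<^sup>2)"
  proof (rule Bochner_Integration.integrable_bound)
    show "integrable lborel (\<lambda>x. 2 * (p x)\<^sup>2 + 2 * (w x)\<^sup>2)"
      using p_sq_integrable w_sq_integrable by simp
    have "(p x - w x)\<^sup>2 \<le> 2 * (p x)\<^sup>2 + 2 * (w x)\<^sup>2" for x
      using sum_sq_le_weighted[of 1 "p x" "- w x"] by simp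
    then show "AE x in lborel. norm ((p x - w x)\<^sup>2) \<le> norm (2 * (p x)\<^sup>2 + 2 * (w x)\<^sup>2)" by simp
  qed measurable
  then have "L2 (\<lambda>x. (p x - w x) *\<^sub>R b)" by (intro L2_scalar(1)) auto
  moreover have "L2 (\<lambda>x. w x *\<^sub>R b)" by (rule L2_scalar(1)[OF _ w_sq_integrable]) simp
  moreover have "((\<lambda>x. (p x - w x) *\<^sub>R b) has_integral (w c *\<^sub>R b - w 0 *\<^sub>R b)) {0..c}" if "0 < c" for c
    using has_integral_scaleR_left[OF w_has_integral[of 0 c], of b] that
    by (simp add: heav_def scaleR_diff_left)
  moreover have "((\<lambda>x. (p x - w x) *\<^sub>R b) has_integral ((w 0 + 1) *\<^sub>R b - w a *\<^sub>R b)) {a..0}" if "a < 0" for a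
    using has_integral_scaleR_left[OF w_has_integral[of a 0], of b] that
    by (simp add: heav_def scaleR_diff_left scaleR_add_left algebra_simps)
  ultimately show ?thesis by (simp add: broken_H1_def)
qed

definition corr :: "cvec \<Rightarrow> cvec \<Rightarrow> cfun" where
  "corr b s x = w x *\<^sub>R b + chi x *\<^sub>R s"

definition corr' :: "cvec \<Rightarrow> cvec \<Rightarrow> cfun" where
  "corr' b s x = (p x - w x) *\<^sub>R b + (- ehat x) *\<^sub>R s"

text \<open>What the corrector leaves after its singular term \<open>p x *\<^sub>R jmap b\<close> is
  split off. No \<open>p\<close> occurs any more, so its L2 norm is controlled by
  \<open>w_norm\<close> and by the size of \<open>s\<close>.\<close>

definition defect :: "real \<Rightarrow> complex \<Rightarrow> cvec \<Rightarrow> cvec \<Rightarrow> cfun" where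
  "defect m z b s x = w x *\<^sub>R (jmap b + kmap m z b) + (ehat x *\<^sub>R jmap s + chi x *\<^sub>R kmap m z s)"

lemma corr_broken_H1: "broken_H1 (corr b s) (corr' b s) ((w 0 + 1) *\<^sub>R b - s) (w 0 *\<^sub>R b + s)"
  using broken_H1_add[OF w_broken_H1 chi_broken_H1]
  unfolding corr_def[abs_def] corr'_def[abs_def] by simp

lemma corr_equation: "- jmap (corr' b s x) + kmap m z (corr b s x) = defect m z b s x - p x *\<^sub>R jmap b"
  by (simp add: corr_def corr'_def defect_def jmap_simps kmap_simps scaleR_add_right scaleR_diff_left)

definition w_norm :: real where
  "w_norm = sqrt (2 * mass * spread)"

lemma w_norm_nonneg: "0 \<le> w_norm"
  using mass_ge_1 spread_nonneg by (simp add: w_norm_def)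

lemma w_l2norm: "l2norm (\<lambda>x. w x *\<^sub>R b) \<le> w_norm * norm b"
  unfolding L2_scalar(2)[OF w_measurable w_sq_integrable] w_norm_def
  by (intro mult_right_mono real_sqrt_le_mono w_L2) auto

lemma chi_l2norm: "l2norm (\<lambda>x. chi x *\<^sub>R s) \<le> 2 * norm s"
  unfolding L2_scalar(2)[OF chi_measurable chi_sq_integrable]
  by (intro mult_right_mono chi_L2) auto

lemma ehat_l2norm: "l2norm (\<lambda>x. ehat x *\<^sub>R s) \<le> 2 * norm s"
  unfolding L2_scalar(2)[OF ehat_measurable ehat_sq_integrable]
  by (intro mult_right_mono ehat_L2) auto

lemma corr_l2norm: "l2norm (corr b s) \<le> w_norm * norm b + 2 * norm s"
  using L2_add(2)[OF L2_scalar(1)[OF w_measurable w_sq_integrable, of b]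
      L2_scalar(1)[OF chi_measurable chi_sq_integrable, of s]] w_l2norm[of b] chi_l2norm[of s]
  unfolding corr_def[abs_def] by linarith

lemma defect_L2: "L2 (defect m z b s)"
  unfolding defect_def[abs_def]
  by (intro L2_add(1) L2_scalar(1) w_sq_integrable chi_sq_integrable ehat_sq_integrable) measurable

lemma defect_l2norm:
  "l2norm (defect m z b s) \<le> (1 + (\<bar>m\<bar> + cmod z)) * (w_norm * norm b + 2 * norm s)"
proof -
  let ?c = "\<bar>m\<bar> + cmod z"
  let ?w = "\<lambda>x. w x *\<^sub>R (jmap b + kmap m z b)" and ?e = "\<lambda>x. ehat x *\<^sub>R jmap s"
    and ?k = "\<lambda>x. chi x *\<^sub>R kmap m z s"
  have L: "L2 ?w" "L2 ?e" "L2 ?k"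
    by (intro L2_scalar(1) w_sq_integrable chi_sq_integrable ehat_sq_integrable; measurable)+
  have "l2norm (defect m z b s) \<le> l2norm ?w + (l2norm ?e + l2norm ?k)"
    using L2_add(2)[OF L(1) L2_add(1)[OF L(2,3)]] L2_add(2)[OF L(2,3)]
    unfolding defect_def[abs_def] by linarith
  also have "l2norm ?w \<le> w_norm * ((1 + ?c) * norm b)"
  proof -
    have "norm (jmap b + kmap m z b) \<le> (1 + ?c) * norm b"
      using norm_triangle_ineq[of "jmap b" "kmap m z b"] norm_kmap[of m z b] by (simp add: distrib_right)
    then show ?thesis
      using w_l2norm[of "jmap b + kmap m z b"] mult_left_mono[OF _ w_norm_nonneg] by fastforce
  qed
  also have "l2norm ?e \<le> 2 * norm s" using ehat_l2norm[of "jmap s"] by simp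
  also have "l2norm ?k \<le> 2 * (?c * norm s)"
    using chi_l2norm[of "kmap m z s"] norm_kmap[of m z s] by simp
  finally show ?thesis by (simp add: algebra_simps)
qed

text \<open>\<open>u0\<close> is the common value at 0 of the two glued halves of
  \<open>u + corr b s\<close>, and \<open>u0 - (w 0 + 1 / 2) *\<^sub>R b\<close> is the mean of the
  traces of \<open>u\<close>. The three error terms come from the modulus of continuity of
  \<open>u\<close>, from \<open>pairing_w\<close>, and from replacing \<open>chi\<close> by the
  sign.\<close>

lemma pairing_estimate:
  assumes B: "broken_H1 u g l r" and l: "u0 = l + (w 0 + 1) *\<^sub>R b - s" and r: "u0 = r + w 0 *\<^sub>R b + s"
  shows "norm ((LINT x|lborel. p x *\<^sub>R (u x + corr b s x)) - u0 + (w 0 + 1 / 2) *\<^sub>R b)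
    \<le> 4 * (l2norm u + l2norm g) * spread + 2 * mass * spread * norm b + spread * norm s"
proof -
  define t where "t x = (if 0 < x then r else l)" for x :: real
  define h where "h x = (if x = 0 then 0 else chi x - sgn x)" for x :: real
  have u: "L2 u" using B by (simp add: broken_H1_def)
  have [measurable]: "u \<in> borel_measurable borel" by (rule L2_measurable[OF u])
  have [measurable]: "t \<in> borel_measurable borel" "h \<in> borel_measurable borel"
    unfolding t_def h_def by measurable
  have ipu: "integrable lborel (\<lambda>x. p x *\<^sub>R u x)"
    by (rule scalar_L2_integrable[OF _ p_sq_integrable u]) simp
  have ipt: "integrable lborel (\<lambda>x. p x *\<^sub>R t x)"
    by (rule p_times_bounded[where B = "max (norm r) (norm l)"]) (auto simp: t_def)
  have ipw: "integrable lborel (\<lambda>x. p x * w x)"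
    by (rule p_times_bounded_real[where B = mass]) (auto intro: w_bound)
  have ipi: "integrable lborel (\<lambda>x. p x * indicator {..0} x)"
    by (rule p_times_bounded_real[where B = 1]) (auto simp: indicator_def)
  have hb: "\<bar>h x\<bar> \<le> 1 * trunc_sqrt x" for x
    using one_minus_exp_le[of x] by (auto simp: h_def chi_def ehat_def sgn_if)
  note iph = abs_weighted_integral_le_spread(1)[OF \<open>h \<in> borel_measurable borel\<close> hb zero_le_one]
  have c: "integrable lborel (\<lambda>x. p x *\<^sub>R u0)" using p_integrable by simp
  have iput: "integrable lborel (\<lambda>x. p x *\<^sub>R (u x - t x))"
    using ipu ipt by (simp add: scaleR_diff_right)
  \<comment> \<open>\<open>p\<close> times the deviation of \<open>w\<close> from the step function
    with its one-sided values \<open>w 0\<close> and \<open>w 0 + 1\<close> at the origin.\<close>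
  let ?c1 = "\<lambda>x. p x * w x - w 0 * p x - p x * indicator {..0} x"
  have i1: "integrable lborel ?c1" using ipw ipi p_integrable by simp
  have "AE x in lborel. p x *\<^sub>R (u x + corr b s x) = p x *\<^sub>R u0 + p x *\<^sub>R (u x - t x) + ?c1 x *\<^sub>R b + (p x * h x) *\<^sub>R s"
    using AE_lborel_singleton[of "0::real"]
  proof eventually_elim
    case (elim x)
    have "u x + corr b s x = u0 + (u x - t x) + (w x - w 0 - indicator {..0} x) *\<^sub>R b + h x *\<^sub>R s"
    proof (cases "0 < x")
      case True
      then have "u0 = t x + w 0 *\<^sub>R b + s" using r by (simp add: t_def)
      then show ?thesis using True by (simp add: corr_def h_def scaleR_diff_left)
    next
      case False
      then have "u0 = t x + (w 0 + 1) *\<^sub>R b - s" using l by (simp add: t_def)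
      then show ?thesis using False elim by (simp add: corr_def h_def scaleR_diff_left scaleR_add_left)
    qed
    then show ?case
      by (simp only: scaleR_add_right scaleR_scaleR) (simp add: algebra_simps)
  qed
  then have "(LINT x|lborel. p x *\<^sub>R (u x + corr b s x))
      = (LINT x|lborel. p x *\<^sub>R u0 + p x *\<^sub>R (u x - t x) + ?c1 x *\<^sub>R b + (p x * h x) *\<^sub>R s)"
    by (intro integral_cong_AE) (auto simp: corr_def)
  also have "\<dots> = u0 + (LINT x|lborel. p x *\<^sub>R (u x - t x)) + (LINT x|lborel. ?c1 x) *\<^sub>R b
      + (LINT x|lborel. p x * h x) *\<^sub>R s"
    using c iput integrable_scaleR_left[OF i1, of b] integrable_scaleR_left[OF iph, of s] p_integrable i1 iph
    by (simp add: p_integral)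
  also have "(LINT x|lborel. ?c1 x) = (LINT x|lborel. p x * w x) - w 0 - (LINT x|lborel. p x * indicator {..0} x)"
    using ipw ipi p_integrable by (simp add: p_integral)
  finally have eq: "(LINT x|lborel. p x *\<^sub>R (u x + corr b s x)) - u0 + (w 0 + 1 / 2) *\<^sub>R b
      = (LINT x|lborel. p x *\<^sub>R (u x - t x))
        + ((LINT x|lborel. p x * w x) + 1 / 2 - (LINT x|lborel. p x * indicator {..0} x)) *\<^sub>R b
        + (LINT x|lborel. p x * h x) *\<^sub>R s"
    by (simp add: scaleR_diff_left scaleR_add_left)
  have n1: "norm (LINT x|lborel. p x *\<^sub>R (u x - t x)) \<le> 4 * (l2norm u + l2norm g) * spread"
  proof -
    have "norm (LINT x|lborel. p x *\<^sub>R (u x - t x)) \<le> (LINT x|lborel. norm (p x *\<^sub>R (u x - t x)))"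
      by (rule integral_norm_bound)
    also have "\<dots> \<le> (LINT x|lborel. 4 * (l2norm u + l2norm g) * (\<bar>p x\<bar> * trunc_sqrt x))"
    proof (rule integral_mono_AE)
      show "integrable lborel (\<lambda>x. norm (p x *\<^sub>R (u x - t x)))" using iput by (rule integrable_norm)
      show "integrable lborel (\<lambda>x. 4 * (l2norm u + l2norm g) * (\<bar>p x\<bar> * trunc_sqrt x))"
        using spread_integrable by simp
      show "AE x in lborel. norm (p x *\<^sub>R (u x - t x)) \<le> 4 * (l2norm u + l2norm g) * (\<bar>p x\<bar> * trunc_sqrt x)"
        using AE_lborel_singleton[of "0::real"]
      proof eventually_elim
        case (elim x)
        from mult_left_mono[OF broken_H1_trace_modulus[OF B elim], of "\<bar>p x\<bar>"]
        show ?case by (simp add: t_def mult_ac)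
      qed
    qed
    finally show ?thesis by (simp add: spread_def)
  qed
  have n2: "norm (((LINT x|lborel. p x * w x) + 1 / 2 - (LINT x|lborel. p x * indicator {..0} x)) *\<^sub>R b)
      \<le> 2 * mass * spread * norm b"
    using mult_right_mono[OF pairing_w, of "norm b"] by simp
  have n3: "norm ((LINT x|lborel. p x * h x) *\<^sub>R s) \<le> spread * norm s"
    using mult_right_mono[OF abs_weighted_integral_le_spread(2)[OF \<open>h \<in> borel_measurable borel\<close> hb zero_le_one], of "norm s"]
    by simp
  show ?thesis
    unfolding eq by (intro norm_triangle_le add_mono n1 n2 n3)
qed

end

section \<open>Comparison of the two operators\<close>

lemma l2norm_minus [simp]: "l2norm (\<lambda>x. - f x) = l2norm f"
  by (simp add: l2norm_def)

text \<open>Totality gives \<open>S\<close> at least the dimension of the space, and injectivity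
  makes \<open>snd\<close> injective on \<open>S\<close>. A linear relation is used instead of a
  map, so that no choice of solutions has to be linear.\<close>

lemma subspace_graph_surj:
  fixes S :: "('a::euclidean_space \<times> 'a) set"
  assumes S: "subspace S" and total: "\<And>y. \<exists>t. (y, t) \<in> S" and inj: "\<And>y. (y, 0) \<in> S \<Longrightarrow> y = 0"
  shows "\<exists>y. (y, t) \<in> S"
proof -
  have "fst ` S = UNIV"
  proof -
    have "y \<in> fst ` S" for y using total[of y] by force
    then show ?thesis by auto
  qed
  then have "DIM('a) \<le> dim S" using dim_image_le[OF linear_fst, of S] by (simp add: dim_UNIV)
  also have "dim S = dim (snd ` S)"
  proof (rule dim_image_eq[OF linear_snd, symmetric])
    have "x = y" if "x \<in> S" "y \<in> S" "snd x = snd y" for x y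
    proof -
      have "x - y = (fst x - fst y, 0)" using that by (simp add: prod_eq_iff)
      then have "(fst x - fst y, 0) \<in> S" using subspace_diff[OF S that(1,2)] by simp
      then have "fst x - fst y = 0" by (rule inj)
      then show ?thesis using that(3) by (simp add: prod_eq_iff)
    qed
    then show "inj_on snd (span S)" unfolding span_eq_iff[THEN iffD2, OF S] by (auto intro: inj_onI)
  qed
  finally have "dim (snd ` S) = DIM('a)" using dim_subset_UNIV[of "snd ` S"] by simp
  then have "span (snd ` S) = UNIV" by (simp add: dim_eq_full)
  moreover have "span (snd ` S) = snd ` S"
    by (simp add: span_eq_iff linear_subspace_image[OF linear_snd S])
  ultimately have "t \<in> snd ` S" by simp
  then show ?thesis by force
qed

text \<open>The vector \<open>q\<close> cancels on the right; it is displayed so that the inner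
  bracket is the error estimated by \<open>pairing_estimate\<close>.\<close>

lemma mean_of_traces:
  fixes u0 b s q :: "'a::real_vector"
  shows "(u0 - (x *\<^sub>R b + s)) + (u0 - ((x + 1) *\<^sub>R b - s)) = 2 *\<^sub>R (q - (q - u0 + (x + 1 / 2) *\<^sub>R b))"
proof -
  have "(2 * x) *\<^sub>R b = x *\<^sub>R b + x *\<^sub>R b" by (simp flip: scaleR_add_left)
  then show ?thesis
    by (simp add: scaleR_right_diff_distrib scaleR_right_distrib scaleR_add_left scaleR_2 algebra_simps)
qed

text \<open>Here \<open>c\<close> stands for |m| + |z|, \<open>C\<close> for the bound on solutions
  of the limit problem, \<open>a\<close> for the bound on \<open>A\<close>, and \<open>V\<close> for
  the L1 norm of the profile. \<open>gconst\<close> bounds the H1 size of a solution by its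
  right-hand side, \<open>dconst\<close> the error of the mean, \<open>sconst\<close> the
  corrector.\<close>

definition gconst :: "real \<Rightarrow> real \<Rightarrow> real" where
  "gconst c C = C + 1 + c * C"
definition dconst :: "real \<Rightarrow> real \<Rightarrow> real \<Rightarrow> real \<Rightarrow> real" where
  "dconst c C a V = 8 * gconst c C * (1 + V * a)"
definition sconst :: "real \<Rightarrow> real \<Rightarrow> real \<Rightarrow> real \<Rightarrow> real" where
  "sconst c C a V = a * (dconst c C a V + 2 * gconst c C) * sqrt (2 * V) + 2 * a * dconst c C a V"
text \<open>Twice a sum of nonnegative terms, so that
  \<open>approx_const * sqrt \<kappa> \<le> 1\<close> makes each term times
  \<open>sqrt \<kappa>\<close> at most 1/2. The terms before the last bracket serve these
  absorptions; the last one is the final error.\<close>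

definition approx_const :: "real \<Rightarrow> real \<Rightarrow> real \<Rightarrow> real \<Rightarrow> real" where
  "approx_const c C a V = 2 * (1 + (2 * V * a + a) + (1 + c) * sconst c C a V
     + (C * ((1 + c) * sconst c C a V) + sconst c C a V))"

text \<open>The hypotheses are circular: \<open>d\<close> is bounded through \<open>b\<close>,
  \<open>s\<close> and \<open>B\<close>, these through \<open>d\<close> and \<open>n\<close>, and
  \<open>n\<close> through \<open>F\<close>. Two absorptions break the circle when \<kappa> is
  small. In the application \<kappa> is \<open>spread\<close>, \<omega> is \<open>w_norm\<close>,
  \<open>B\<close> the H1 size of the corrected function, \<open>N\<close> and \<open>n\<close> the
  norms of the old and new right-hand sides, \<open>F\<close> that of the defect, and
  \<open>E\<close> that of the difference of solutions.\<close>

lemma perturbation_arith: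
  fixes c C a V \<kappa> :: real
  assumes nn: "0 \<le> c" "0 \<le> C" "0 \<le> a" "0 \<le> V" "0 \<le> \<kappa>" "0 \<le> n" "0 \<le> d" "0 \<le> N"
    and d: "d \<le> 4 * B * \<kappa> + 2 * V * \<kappa> * b + \<kappa> * s"
    and b: "b \<le> a * q" and s: "s \<le> a * d" and q: "q \<le> d + 2 * B" and B: "B \<le> gconst c C * n"
    and F: "F \<le> (1 + c) * (\<omega> * b + 2 * s)" and n: "n \<le> N + F"
    and E: "E \<le> C * F + (\<omega> * b + 2 * s)" and \<omega>: "\<omega> = sqrt (2 * V) * sqrt \<kappa>"
    and small: "approx_const c C a V * sqrt \<kappa> \<le> 1"
  shows "E \<le> approx_const c C a V * sqrt \<kappa> * N"
proof -
  define r where "r = sqrt \<kappa>"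
  define C2 where "C2 = gconst c C"
  define c1 where "c1 = dconst c C a V"
  define c5 where "c5 = sconst c C a V"
  define M where "M = approx_const c C a V"
  have C2: "0 \<le> C2" unfolding C2_def gconst_def using nn by simp
  have c1: "c1 = 8 * C2 * (1 + V * a)" "0 \<le> c1" using C2 nn by (simp_all add: c1_def dconst_def C2_def)
  have c5: "c5 = a * (c1 + 2 * C2) * sqrt (2 * V) + 2 * a * c1" by (simp add: c5_def sconst_def c1_def C2_def)
  have c50: "0 \<le> c5" unfolding c5 using nn C2 c1 by simp
  have M: "M = 2 * (1 + (2 * V * a + a) + (1 + c) * c5 + (C * ((1 + c) * c5) + c5))"
    by (simp add: M_def approx_const_def c5_def)
  have r: "0 \<le> r" "r * r = \<kappa>" using nn by (simp_all add: r_def)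
  have t: "0 \<le> 2 * V * a + a" "0 \<le> (1 + c) * c5" "0 \<le> C * ((1 + c) * c5)" using nn c50 by simp_all
  have Mr: "M * r \<le> 1" using small by (simp add: M_def r_def)
  have part: "x * r \<le> 1 / 2" if "2 * x \<le> M" for x
    using mult_right_mono[OF that r(1)] Mr by simp
  have r1: "r \<le> 1" using part[of 1] t c50 by (simp add: M)
  have p1: "(2 * V * a + a) * r \<le> 1 / 2" by (rule part) (use t c50 in \<open>simp add: M\<close>)
  have p2: "((1 + c) * c5) * r \<le> 1 / 2" by (rule part) (use t c50 in \<open>simp add: M\<close>)
  have kr: "\<kappa> \<le> r" using mult_left_mono[OF r1 r(1)] r(2) by simp
  have k1: "\<kappa> \<le> 1" using kr r1 by simp
  have C2n: "0 \<le> C2 * n" using C2 nn by simp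
  have q': "q \<le> d + 2 * (C2 * n)" using q B by (simp add: C2_def)
  have b': "b \<le> a * (d + 2 * (C2 * n))" using b mult_left_mono[OF q' nn(3)] by simp
  have "d \<le> \<kappa> * (4 * B + 2 * V * b + s)" using d by (simp add: algebra_simps)
  also have "\<dots> \<le> \<kappa> * (4 * (C2 * n) + 2 * V * (a * (d + 2 * (C2 * n))) + a * d)"
    using B b' s nn by (intro mult_left_mono add_mono) (auto simp: C2_def)
  also have "\<dots> = \<kappa> * (4 * C2 * (1 + V * a) * n) + (2 * V * a + a) * \<kappa> * d" by (simp add: algebra_simps)
  \<comment> \<open>First absorption: half of \<open>d\<close> goes to the left-hand side, which
    doubles the factor 4 to the 8 in \<open>dconst\<close>.\<close>
  also have "(2 * V * a + a) * \<kappa> * d \<le> 1 / 2 * d"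
  proof (rule mult_right_mono)
    show "(2 * V * a + a) * \<kappa> \<le> 1 / 2" using mult_left_mono[OF kr t(1)] p1 by linarith
  qed (rule nn)
  finally have d': "d \<le> \<kappa> * c1 * n" by (simp add: c1 algebra_simps)
  have d1: "d \<le> c1 * n"
  proof -
    have "\<kappa> * (c1 * n) \<le> 1 * (c1 * n)" by (rule mult_right_mono[OF k1]) (use c1 nn in simp)
    then show ?thesis using d' by (simp add: mult.assoc)
  qed
  have dr: "d \<le> r * (c1 * n)"
  proof -
    have "\<kappa> * (c1 * n) \<le> r * (c1 * n)" by (rule mult_right_mono[OF kr]) (use c1 nn in simp)
    then show ?thesis using d' by (simp add: mult.assoc)
  qed
  have b2: "b \<le> a * (c1 + 2 * C2) * n"
  proof -
    have "a * (d + 2 * (C2 * n)) \<le> a * (c1 * n + 2 * (C2 * n))"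
      using d1 nn by (intro mult_left_mono) auto
    then show ?thesis using b' by (simp add: algebra_simps)
  qed
  have G: "\<omega> * b + 2 * s \<le> c5 * r * n"
  proof -
    have "\<omega> * b \<le> \<omega> * (a * (c1 + 2 * C2) * n)"
      using b2 nn by (intro mult_left_mono) (auto simp: \<omega>)
    also have "\<dots> = a * (c1 + 2 * C2) * sqrt (2 * V) * r * n" by (simp add: \<omega> r_def)
    finally have 1: "\<omega> * b \<le> a * (c1 + 2 * C2) * sqrt (2 * V) * r * n" .
    have "s \<le> a * (r * (c1 * n))" using s mult_left_mono[OF dr nn(3)] by simp
    then show ?thesis using 1 by (simp add: c5 algebra_simps)
  qed
  have F': "F \<le> (1 + c) * c5 * r * n"
  proof -
    have "(1 + c) * (\<omega> * b + 2 * s) \<le> (1 + c) * (c5 * r * n)"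
      by (rule mult_left_mono[OF G]) (use nn in simp)
    then show ?thesis using F by (simp only: mult.assoc)
  qed
  \<comment> \<open>Second absorption, now of the defect into \<open>n\<close>; it is the source of
    the factor 2 in \<open>n \<le> 2 * N\<close>.\<close>
  have "F \<le> 1 / 2 * n" using F' mult_right_mono[OF p2 nn(6)] by simp
  then have n2: "n \<le> 2 * N" using n by simp
  have "E \<le> C * ((1 + c) * c5 * r * n) + c5 * r * n"
    using E G mult_left_mono[OF F' nn(2)] by linarith
  also have "\<dots> = (C * ((1 + c) * c5) + c5) * r * n" by (simp add: algebra_simps)
  also have "\<dots> \<le> (C * ((1 + c) * c5) + c5) * r * (2 * N)"
    using n2 t c50 r by (intro mult_left_mono) auto
  also have "\<dots> = (2 * (C * ((1 + c) * c5) + c5)) * r * N" by simp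
  also have "\<dots> \<le> M * r * N"
    using t c50 r nn by (intro mult_right_mono) (auto simp: M)
  finally show ?thesis by (simp add: M_def r_def)
qed

text \<open>All that is kept of the resolvent of \<open>D_A\<close> is an a priori bound and
  existence. Uniqueness is contained in the bound, applied to the right-hand side 0.\<close>

locale dirac_approx = mollifier +
  fixes m :: real and A :: "complex ^ 2 ^ 2" and z :: complex and C a :: real
  assumes a: "0 \<le> a" "\<And>y. norm (A *v y) \<le> a * norm y"
    and C: "0 \<le> C"
    and stable: "\<And>u g l r f. dom_A m A z u g l r f \<Longrightarrow> l2norm u \<le> C * l2norm f"
    and solvable: "\<And>f. L2 f \<Longrightarrow> \<exists>u g l r. dom_A m A z u g l r f"
begin

definition rate :: real where
  "rate = approx_const (\<bar>m\<bar> + cmod z) C a mass * sqrt spread"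

definition src :: "cvec \<Rightarrow> cvec" where
  "src q = - jmap (A *v q)"

lemma jmap_src [simp]: "jmap (src q) = A *v q"
  by (simp add: src_def jmap_simps)

lemma norm_src: "norm (src q) \<le> a * norm q"
  using a by (simp add: src_def)

text \<open>Subtracting \<open>corr\<close> turns a solution for the regularised operator into one for \<open>D_A\<close>
  with a small change of the right-hand side.\<close>

lemma resolvent_difference:
  assumes E: "dom_E m A z p u g f" and D: "dom_A m A z u1 g1 l1 r1 f" and small: "rate \<le> 1"
  shows "l2norm (\<lambda>x. u x - u1 x) \<le> rate * l2norm f"
proof -
  define q where "q = (LINT x|lborel. p x *\<^sub>R u x)"
  define b where "b = src q"
  define d where "d = q - u 0 + (w 0 + 1 / 2) *\<^sub>R b"
  \<comment> \<open>With \<open>b = src q\<close> the boundary condition for the corrected function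
    fails by \<open>2 *\<^sub>R (A *v d) - 4 *\<^sub>R jmap s\<close>; this \<open>s\<close> makes
    the failure vanish.\<close>
  define s where "s = - ((1 / 2) *\<^sub>R jmap (A *v d))"
  define u' where "u' x = u x - corr b s x" for x
  define g' where "g' x = g x - corr' b s x" for x
  define l where "l = u 0 - ((w 0 + 1) *\<^sub>R b - s)"
  define r where "r = u 0 - (w 0 *\<^sub>R b + s)"
  define f' where "f' x = f x - defect m z b s x" for x
  have H: "is_H1 u g" and f: "L2 f" using E by (simp_all add: dom_E_def)
  have u: "L2 u" using H by (simp add: is_H1_def)
  have ae: "AE x in lborel. f x = - jmap (g x) + kmap m z (u x) + p x *\<^sub>R (A *v q)"
    using E by (simp add: dom_E_def q_def)
  have js: "jmap s = (1 / 2) *\<^sub>R (A *v d)" by (simp add: s_def jmap_simps)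
  have mean: "r + l = 2 *\<^sub>R (q - d)"
    unfolding r_def l_def d_def by (rule mean_of_traces)
  have B: "broken_H1 u' g' l r"
    unfolding u'_def g'_def l_def r_def
    by (rule broken_H1_diff[OF is_H1_imp_broken_H1[OF H] corr_broken_H1])
  have f': "L2 f'" unfolding f'_def by (rule L2_diff(1)[OF f defect_L2])
  have DA: "dom_A m A z u' g' l r f'"
    unfolding dom_A_def
  proof (intro conjI B f')
    have "r - l = b - 2 *\<^sub>R s" by (simp add: r_def l_def scaleR_add_left scaleR_2)
    then have "2 *\<^sub>R jmap (r - l) = 2 *\<^sub>R (A *v (q - d))"
      by (simp add: jmap_simps js mat_simps b_def scaleR_right_diff_distrib)
    then show "2 *\<^sub>R jmap (r - l) = A *v (r + l)" by (simp add: mat_simps mean)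
    show "AE x in lborel. f' x = - jmap (g' x) + kmap m z (u' x)"
      using ae
    proof eventually_elim
      case (elim x)
      have "- jmap (g' x) + kmap m z (u' x)
          = (- jmap (g x) + kmap m z (u x)) - (- jmap (corr' b s x) + kmap m z (corr b s x))"
        by (simp add: g'_def u'_def jmap_simps kmap_simps)
      also have "\<dots> = f' x"
        unfolding corr_equation by (simp add: f'_def elim b_def)
      finally show ?case by simp
    qed
  qed
  have pair: "norm d \<le> 4 * (l2norm u' + l2norm g') * spread + 2 * mass * spread * norm b + spread * norm s"
  proof -
    have "u 0 = l + (w 0 + 1) *\<^sub>R b - s" "u 0 = r + w 0 *\<^sub>R b + s" by (simp_all add: l_def r_def)
    from pairing_estimate[OF B this] show ?thesis by (simp add: u'_def q_def[symmetric] d_def)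
  qed
  have qd: "norm q \<le> norm d + 2 * (l2norm u' + l2norm g')"
  proof -
    have "q = d + (1 / 2) *\<^sub>R (r + l)" by (simp add: mean)
    then have "norm q \<le> norm d + norm ((1 / 2) *\<^sub>R (r + l))" using norm_triangle_ineq by metis
    moreover have "norm ((1 / 2) *\<^sub>R (r + l)) \<le> 2 * (l2norm u' + l2norm g')"
      using norm_triangle_ineq[of r l] broken_H1_trace[OF B] by simp
    ultimately show ?thesis by linarith
  qed
  let ?c = "\<bar>m\<bar> + cmod z" and ?F = "l2norm (defect m z b s)"
  have st: "l2norm u' \<le> C * l2norm f'" by (rule stable[OF DA])
  have B': "l2norm u' + l2norm g' \<le> gconst ?c C * l2norm f'"
  proof -
    have "?c * l2norm u' \<le> ?c * (C * l2norm f')" by (rule mult_left_mono[OF st]) simp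
    then show ?thesis using st dom_A_deriv_bound[OF DA] by (simp add: gconst_def distrib_right mult.assoc)
  qed
  have n: "l2norm f' \<le> l2norm f + ?F" unfolding f'_def by (rule L2_diff(2)[OF f defect_L2])
  have s: "norm s \<le> a * norm d"
  proof -
    have "norm s = norm (A *v d) / 2" by (simp add: s_def)
    then show ?thesis using a(2)[of d] norm_ge_zero[of "A *v d"] by linarith
  qed
  \<comment> \<open>The corrected function and \<open>u1\<close> satisfy the same boundary
    condition, and their right-hand sides differ exactly by the defect, so stability applies to the
    difference.\<close>
  have diff: "l2norm (\<lambda>x. u x - u1 x) \<le> C * ?F + (w_norm * norm b + 2 * norm s)"
  proof -
    have "l2norm (\<lambda>x. u' x - u1 x) \<le> C * l2norm (\<lambda>x. f' x - f x)" by (rule stable[OF dom_A_diff[OF DA D]])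
    also have "l2norm (\<lambda>x. f' x - f x) = ?F" by (simp add: f'_def)
    finally have 1: "l2norm (\<lambda>x. u' x - u1 x) \<le> C * ?F" .
    have u1: "L2 u1" "L2 u'" using D B by (simp_all add: dom_A_def broken_H1_def)
    have c: "L2 (corr b s)" using corr_broken_H1 by (simp add: broken_H1_def)
    have "(\<lambda>x. u x - u1 x) = (\<lambda>x. (u' x - u1 x) + corr b s x)" by (simp add: u'_def)
    then show ?thesis using L2_add(2)[OF L2_diff(1)[OF u1(2,1)] c] 1 corr_l2norm[of b s] by simp
  qed
  show ?thesis
    unfolding rate_def
  proof (rule perturbation_arith[OF _ C a(1) _ spread_nonneg _ _ _ pair _ s qd B' defect_l2norm n diff])
    show "norm b \<le> a * norm q" using norm_src by (simp add: b_def)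
    show "w_norm = sqrt (2 * mass) * sqrt spread" by (simp add: w_norm_def real_sqrt_mult)
  qed (use small mass_ge_1 in \<open>simp_all add: rate_def\<close>)
qed

text \<open>Solvability is a square linear system: \<open>y\<close> collects the trial value of the pairing
  with \<open>p\<close> and the amplitude of \<open>chi\<close>, \<open>t\<close> the jump and the self-consistency error.\<close>

definition trial :: "cvec \<times> cvec \<Rightarrow> cvec \<times> cvec \<Rightarrow> cfun \<Rightarrow> bool" where
  "trial y t f \<longleftrightarrow> (\<exists>u g l r. dom_A m A z u g l r (\<lambda>x. f x - defect m z (src (fst y)) (snd y) x) \<and>
     fst t = r - l - src (fst y) + 2 *\<^sub>R snd y \<and>
     snd t = fst y - (LINT x|lborel. p x *\<^sub>R (u x + corr (src (fst y)) (snd y) x)))"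

lemma src_linear: "src (q + q') = src q + src q'" "src (c *\<^sub>R q) = c *\<^sub>R src q"
  by (simp_all add: src_def jmap_simps mat_simps)

lemma defect_linear:
  "defect m z (b + b') (s + s') x = defect m z b s x + defect m z b' s' x"
  "defect m z (c *\<^sub>R b) (c *\<^sub>R s) x = c *\<^sub>R defect m z b s x"
  by (simp_all add: defect_def jmap_simps kmap_simps algebra_simps)

lemma corr_linear:
  "corr (b + b') (s + s') x = corr b s x + corr b' s' x"
  "corr (c *\<^sub>R b) (c *\<^sub>R s) x = c *\<^sub>R corr b s x"
  by (simp_all add: corr_def algebra_simps)

lemma p_dom_A_integrable:
  assumes "dom_A m A z u g l r f"
  shows "integrable lborel (\<lambda>x. p x *\<^sub>R (u x + corr b s x))"
proof -
  have "L2 u" "L2 (corr b s)" using assms corr_broken_H1 by (simp_all add: dom_A_def broken_H1_def)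
  then show ?thesis by (intro scalar_L2_integrable[OF _ p_sq_integrable] L2_add) simp_all
qed

lemma trial_add:
  assumes "trial y t f" "trial y' t' f'"
  shows "trial (y + y') (t + t') (\<lambda>x. f x + f' x)"
proof -
  let ?b = "src (fst y)" and ?b' = "src (fst y')"
  from assms(1) obtain u g l r where 1: "dom_A m A z u g l r (\<lambda>x. f x - defect m z ?b (snd y) x)"
    "fst t = r - l - ?b + 2 *\<^sub>R snd y" "snd t = fst y - (LINT x|lborel. p x *\<^sub>R (u x + corr ?b (snd y) x))"
    unfolding trial_def by blast
  from assms(2) obtain u' g' l' r' where 2: "dom_A m A z u' g' l' r' (\<lambda>x. f' x - defect m z ?b' (snd y') x)"
    "fst t' = r' - l' - ?b' + 2 *\<^sub>R snd y'" "snd t' = fst y' - (LINT x|lborel. p x *\<^sub>R (u' x + corr ?b' (snd y') x))"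
    unfolding trial_def by blast
  have "(\<lambda>x. (f x - defect m z ?b (snd y) x) + (f' x - defect m z ?b' (snd y') x))
      = (\<lambda>x. f x + f' x - defect m z (src (fst (y + y'))) (snd (y + y')) x)"
    by (simp add: defect_linear src_linear algebra_simps)
  note D = dom_A_add[OF 1(1) 2(1), unfolded this]
  have I: "(LINT x|lborel. p x *\<^sub>R ((u x + u' x) + corr (src (fst (y + y'))) (snd (y + y')) x))
      = (LINT x|lborel. p x *\<^sub>R (u x + corr ?b (snd y) x)) + (LINT x|lborel. p x *\<^sub>R (u' x + corr ?b' (snd y') x))"
    unfolding Bochner_Integration.integral_add[OF p_dom_A_integrable[OF 1(1)] p_dom_A_integrable[OF 2(1)], symmetric]
    by (rule Bochner_Integration.integral_cong) (simp_all add: corr_linear src_linear algebra_simps)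
  show ?thesis
    unfolding trial_def
  proof (intro exI conjI)
    show "fst (t + t') = r + r' - (l + l') - src (fst (y + y')) + 2 *\<^sub>R snd (y + y')"
      by (simp add: 1(2) 2(2) src_linear scaleR_right_distrib)
    show "snd (t + t') = fst (y + y') - (LINT x|lborel. p x *\<^sub>R ((u x + u' x) + corr (src (fst (y + y'))) (snd (y + y')) x))"
      unfolding I by (simp add: 1(3) 2(3))
  qed (rule D)
qed

lemma trial_scaleR:
  assumes "trial y t f"
  shows "trial (c *\<^sub>R y) (c *\<^sub>R t) (\<lambda>x. c *\<^sub>R f x)"
proof -
  let ?b = "src (fst y)"
  from assms obtain u g l r where 1: "dom_A m A z u g l r (\<lambda>x. f x - defect m z ?b (snd y) x)"
    "fst t = r - l - ?b + 2 *\<^sub>R snd y" "snd t = fst y - (LINT x|lborel. p x *\<^sub>R (u x + corr ?b (snd y) x))"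
    unfolding trial_def by blast
  have "(\<lambda>x. c *\<^sub>R (f x - defect m z ?b (snd y) x))
      = (\<lambda>x. c *\<^sub>R f x - defect m z (src (fst (c *\<^sub>R y))) (snd (c *\<^sub>R y)) x)"
    by (simp add: defect_linear src_linear scaleR_diff_right)
  note D = dom_A_scaleR[OF 1(1), of c, unfolded this]
  have I: "(LINT x|lborel. p x *\<^sub>R (c *\<^sub>R u x + corr (src (fst (c *\<^sub>R y))) (snd (c *\<^sub>R y)) x))
      = c *\<^sub>R (LINT x|lborel. p x *\<^sub>R (u x + corr ?b (snd y) x))"
    unfolding integral_scaleR_right[symmetric]
    by (rule Bochner_Integration.integral_cong) (simp_all add: corr_linear src_linear scaleR_add_right mult.commute)
  show ?thesis
    unfolding trial_def
  proof (intro exI conjI)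
    show "fst (c *\<^sub>R t) = c *\<^sub>R r - c *\<^sub>R l - src (fst (c *\<^sub>R y)) + 2 *\<^sub>R snd (c *\<^sub>R y)"
      by (simp add: 1(2) src_linear scaleR_right_distrib scaleR_right_diff_distrib)
    show "snd (c *\<^sub>R t) = fst (c *\<^sub>R y) - (LINT x|lborel. p x *\<^sub>R (c *\<^sub>R u x + corr (src (fst (c *\<^sub>R y))) (snd (c *\<^sub>R y)) x))"
      unfolding I by (simp add: 1(3) scaleR_right_diff_distrib)
  qed (rule D)
qed

lemma trial_total:
  assumes "L2 f" shows "\<exists>t. trial y t f"
proof -
  let ?b = "src (fst y)"
  obtain u g l r where D: "dom_A m A z u g l r (\<lambda>x. f x - defect m z ?b (snd y) x)"
    using solvable[OF L2_diff(1)[OF assms defect_L2]] by blast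
  have "trial y (r - l - ?b + 2 *\<^sub>R snd y, fst y - (LINT x|lborel. p x *\<^sub>R (u x + corr ?b (snd y) x))) f"
    unfolding trial_def fst_conv snd_conv by (intro exI conjI, rule D, rule refl, rule refl)
  then show ?thesis ..
qed

text \<open>The first component of \<open>t\<close> is the jump at 0 of the trial function plus its
  corrector. So \<open>t = 0\<close> says that this sum glues to an H1 function and that the
  presumed pairing value is its actual one.\<close>

lemma trial_consistent:
  assumes T: "trial y 0 f" and f: "L2 f"
  obtains u g u' g' l r where "dom_E m A z p u g f" "AE x in lborel. u x = u' x + corr (src (fst y)) (snd y) x"
    "fst y = (LINT x|lborel. p x *\<^sub>R u x)" "dom_A m A z u' g' l r (\<lambda>x. f x - defect m z (src (fst y)) (snd y) x)"
proof -
  let ?b = "src (fst y)" and ?s = "snd y"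
  from T obtain u' g' l r where D: "dom_A m A z u' g' l r (\<lambda>x. f x - defect m z ?b ?s x)"
    and jump: "0 = r - l - ?b + 2 *\<^sub>R ?s" and q: "fst y = (LINT x|lborel. p x *\<^sub>R (u' x + corr ?b ?s x))"
    unfolding trial_def by auto
  have B: "broken_H1 u' g' l r" using D by (simp add: dom_A_def)
  define t where "t = r + (w 0 *\<^sub>R ?b + ?s)"
  have t: "l + ((w 0 + 1) *\<^sub>R ?b - ?s) = t"
    using jump by (simp add: t_def scaleR_add_left scaleR_2 algebra_simps)
  define v where "v x = u' x + corr ?b ?s x" for x
  define g where "g x = g' x + corr' ?b ?s x" for x
  have "broken_H1 v g t t"
    using broken_H1_add[OF B corr_broken_H1, of ?b ?s] unfolding t t_def[symmetric] v_def[symmetric] g_def[symmetric] .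
  then have H: "is_H1 (v(0 := t)) g" and v: "L2 v"
    by (auto intro: broken_H1_imp_is_H1 simp: broken_H1_def)
  have vm: "v \<in> borel_measurable borel" "v(0 := t) \<in> borel_measurable borel"
    using v H by (auto intro: L2_measurable simp: is_H1_def)
  have ae: "AE x in lborel. (v(0 := t)) x = v x" by (rule AE_fun_upd_lborel)
  have q': "fst y = (LINT x|lborel. p x *\<^sub>R (v(0 := t)) x)"
  proof -
    have "(LINT x|lborel. p x *\<^sub>R (v(0 := t)) x) = (LINT x|lborel. p x *\<^sub>R v x)"
    proof (rule integral_cong_AE)
      show "AE x in lborel. p x *\<^sub>R (v(0 := t)) x = p x *\<^sub>R v x"
        using ae by eventually_elim simp
    qed (use vm in measurable)
    then show ?thesis using q by (simp add: v_def)
  qed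
  have "dom_E m A z p (v(0 := t)) g f"
    unfolding dom_E_def
  proof (intro conjI H f)
    have "AE x in lborel. f x - defect m z ?b ?s x = - jmap (g' x) + kmap m z (u' x)"
      using D by (simp add: dom_A_def)
    with ae show "AE x in lborel. f x = - jmap (g x) + kmap m z ((v(0 := t)) x)
        + p x *\<^sub>R (A *v (LINT y|lborel. p y *\<^sub>R (v(0 := t)) y))"
    proof eventually_elim
      case (elim x)
      have "- jmap (g x) + kmap m z (v x)
          = (- jmap (g' x) + kmap m z (u' x)) + (- jmap (corr' ?b ?s x) + kmap m z (corr ?b ?s x))"
        by (simp add: g_def v_def jmap_simps kmap_simps)
      also have "\<dots> = f x - p x *\<^sub>R (A *v fst y)"
        unfolding corr_equation elim(2)[symmetric] by simp
      finally show ?case unfolding elim(1) q'[symmetric] by simp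
    qed
  qed
  moreover have "AE x in lborel. (v(0 := t)) x = u' x + corr ?b ?s x" using ae by (simp add: v_def)
  ultimately show thesis using that q' D by blast
qed

lemma dom_A_zero: "dom_A m A z (\<lambda>x. 0) (\<lambda>x. 0) 0 0 (\<lambda>x. 0)"
  using linear_0[OF jmap_linear] linear_0[OF kmap_linear] linear_0[OF mat_linear]
  by (simp add: dom_A_def broken_H1_def)

text \<open>Comparison with the zero solution gives \<open>u = 0\<close>, hence a zero pairing. What
  remains is a multiple of \<open>chi\<close> satisfying the condition of \<open>D_A\<close>: its
  traces sum to 0, so its jump is 0 too, and the multiple is 0.\<close>

lemma trial_injective:
  assumes T: "trial y 0 (\<lambda>x. 0)" and small: "rate \<le> 1"
  shows "y = 0"
proof -
  from trial_consistent[OF T L2_zero] obtain u g u' g' l r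
    where E: "dom_E m A z p u g (\<lambda>x. 0)"
      and ae: "AE x in lborel. u x = u' x + corr (src (fst y)) (snd y) x"
      and q: "fst y = (LINT x|lborel. p x *\<^sub>R u x)"
      and D: "dom_A m A z u' g' l r (\<lambda>x. 0 - defect m z (src (fst y)) (snd y) x)" by blast
  have u: "L2 u" using E by (simp add: dom_E_def is_H1_def)
  have "l2norm u \<le> 0" using resolvent_difference[OF E dom_A_zero small] by simp
  then have u0: "AE x in lborel. u x = 0" by (rule l2norm_eq_0_AE[OF u])
  have "(LINT x|lborel. p x *\<^sub>R u x) = 0"
  proof (rule integral_eq_zero_AE)
    show "AE x in lborel. p x *\<^sub>R u x = 0" using u0 by eventually_elim simp
  qed
  then have y1: "fst y = 0" using q by simp
  then have b: "src (fst y) = 0" using src_linear(2)[of 0 0] by simp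
  have B: "broken_H1 u' g' l r" using D by (simp add: dom_A_def)
  have S: "broken_H1 (\<lambda>x. u' x + corr 0 (snd y) x) (\<lambda>x. g' x + corr' 0 (snd y) x) (l - snd y) (r + snd y)"
    using broken_H1_add[OF B corr_broken_H1[of 0 "snd y"]] by simp
  have "AE x in lborel. u' x + corr 0 (snd y) x = 0" using u0 ae b by auto
  from broken_H1_zero_trace[OF S this] have lr: "r = - snd y" "l = snd y"
    by (simp_all add: eq_neg_iff_add_eq_0)
  have sum0: "r + l = 0" using lr by simp
  have "2 *\<^sub>R jmap (r - l) = 0" using D linear_0[OF mat_linear] by (simp add: dom_A_def sum0)
  then have "norm (r - l) = 0" by (metis norm_jmap norm_zero scaleR_eq_0_iff zero_neq_numeral)
  then have "2 *\<^sub>R l = 0" using sum0 by (simp add: scaleR_2)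
  then have "snd y = 0" using lr by (metis scaleR_eq_0_iff zero_neq_numeral)
  then show ?thesis using y1 by (simp add: prod_eq_iff)
qed

text \<open>The trial with \<open>y = 0\<close> has some error \<open>t\<close>; a homogeneous trial
  with error \<open>- t\<close>, which exists by injectivity and dimension, is added to it.\<close>

lemma dom_E_solvable:
  assumes f: "L2 f" and small: "rate \<le> 1"
  shows "\<exists>u g. dom_E m A z p u g f"
proof -
  obtain t where t: "trial 0 t f" using trial_total[OF f] by blast
  have "subspace {(y, t). trial y t (\<lambda>x. 0)}"
    unfolding subspace_def
  proof (intro conjI ballI allI)
    obtain t0 where "trial 0 t0 (\<lambda>x. 0)" using trial_total[OF L2_zero] by blast
    from trial_scaleR[OF this, of 0] show "0 \<in> {(y, t). trial y t (\<lambda>x. 0)}" by (simp add: zero_prod_def)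
    show "x + y \<in> {(y, t). trial y t (\<lambda>x. 0)}"
      if "x \<in> {(y, t). trial y t (\<lambda>x. 0)}" "y \<in> {(y, t). trial y t (\<lambda>x. 0)}" for x y
      using that trial_add[of "fst x" "snd x" "\<lambda>x. 0" "fst y" "snd y" "\<lambda>x. 0"] by (auto simp: case_prod_unfold)
    show "c *\<^sub>R x \<in> {(y, t). trial y t (\<lambda>x. 0)}" if "x \<in> {(y, t). trial y t (\<lambda>x. 0)}" for c x
      using that trial_scaleR[of "fst x" "snd x" "\<lambda>x. 0" c] by (auto simp: case_prod_unfold)
  qed
  then have "\<exists>y. (y, - t) \<in> {(y, t). trial y t (\<lambda>x. 0)}"
    by (rule subspace_graph_surj) (use trial_total[OF L2_zero] trial_injective[OF _ small] in auto)
  then obtain y where "trial y (- t) (\<lambda>x. 0)" by auto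
  from trial_add[OF this t] have "trial y 0 f" by simp
  from trial_consistent[OF this f] show ?thesis by blast
qed

end

section \<open>Resolvents\<close>

lemma L2_smult:
  fixes z :: complex
  assumes "L2 f" shows "L2 (\<lambda>x. z *s f x)"
proof (rule L2_linear(1)[OF assms])
  show "bounded_linear (\<lambda>y::cvec. z *s y)"
    unfolding linear_conv_bounded_linear[symmetric]
    by (rule linearI) (simp_all add: vec_eq_iff algebra_simps)
  show "norm (z *s y) \<le> cmod z * norm y" for y :: cvec
    by (simp add: norm_cvec norm_mult power_mult_distrib flip: distrib_left) (simp add: real_sqrt_mult)
qed simp

lemma D_A_iff:
  "D_A m A \<psi> \<phi> \<longleftrightarrow> L2 \<psi> \<and> L2 \<phi> \<and>
     (\<exists>u g l r. (AE x in lborel. \<psi> x = u x) \<and> dom_A m A z u g l r (\<lambda>x. \<phi> x - z *s \<psi> x))"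
proof (intro iffI conjI)
  assume D: "D_A m A \<psi> \<phi>"
  then show \<psi>: "L2 \<psi>" and \<phi>: "L2 \<phi>" by (simp_all add: D_A_def)
  from D obtain u g l r where u: "AE x in lborel. \<psi> x = u x" and g: "L2 g"
    and R: "\<forall>b>0. (g has_integral (u b - r)) {0..b}" and L: "\<forall>a<0. (g has_integral (l - u a)) {a..0}"
    and bc: "(mat (2 * \<i>) ** sigma1 - A) *v r = (mat (2 * \<i>) ** sigma1 + A) *v l"
    and e: "AE x in lborel. \<phi> x = dirac_expr m u g x" unfolding D_A_def by blast
  have "u \<in> borel_measurable borel" by (rule borel_measurable_broken[OF g]) (use R L in auto)
  then have "L2 u" by (rule L2_cong_AE[OF \<psi> _ u])
  moreover have "AE x in lborel. \<phi> x - z *s \<psi> x = - jmap (g x) + kmap m z (u x)"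
    using u e by eventually_elim (simp add: dirac_expr_eq)
  ultimately have "dom_A m A z u g l r (\<lambda>x. \<phi> x - z *s \<psi> x)"
    using g R L bc \<psi> \<phi>
    by (simp add: dom_A_def broken_H1_def boundary_condition_iff L2_diff(1) L2_smult)
  then show "\<exists>u g l r. (AE x in lborel. \<psi> x = u x) \<and> dom_A m A z u g l r (\<lambda>x. \<phi> x - z *s \<psi> x)"
    using u by blast
next
  assume "L2 \<psi> \<and> L2 \<phi> \<and> (\<exists>u g l r. (AE x in lborel. \<psi> x = u x) \<and> dom_A m A z u g l r (\<lambda>x. \<phi> x - z *s \<psi> x))"
  then obtain u g l r where h: "L2 \<psi>" "L2 \<phi>" and u: "AE x in lborel. \<psi> x = u x"
    and d: "dom_A m A z u g l r (\<lambda>x. \<phi> x - z *s \<psi> x)" by blast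
  have "AE x in lborel. \<phi> x - z *s \<psi> x = - jmap (g x) + kmap m z (u x)" using d by (simp add: dom_A_def)
  with u have "AE x in lborel. \<phi> x = dirac_expr m u g x"
  proof eventually_elim
    case (elim x)
    then have "\<phi> x - z *s u x = dirac_expr m u g x - z *s u x" unfolding dirac_expr_eq by simp
    then show ?case by simp
  qed
  with h u d show "D_A m A \<psi> \<phi>"
    unfolding D_A_def dom_A_def broken_H1_def boundary_condition_iff by blast
qed

lemma D_A_eps_iff:
  assumes [measurable]: "v_eps v \<epsilon> \<in> borel_measurable borel"
  shows "D_A_eps m A v \<epsilon> \<psi> \<phi> \<longleftrightarrow> L2 \<psi> \<and> L2 \<phi> \<and>
     (\<exists>u g. (AE x in lborel. \<psi> x = u x) \<and> dom_E m A z (v_eps v \<epsilon>) u g (\<lambda>x. \<phi> x - z *s \<psi> x))"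
proof -
  let ?p = "v_eps v \<epsilon>"
  have I: "(LINT y|lborel. ?p y *\<^sub>R \<psi> y) = (LINT y|lborel. ?p y *\<^sub>R u y)"
    if "L2 \<psi>" "L2 u" and u: "AE x in lborel. \<psi> x = u x" for u
  proof (rule integral_cong_AE)
    note [measurable] = L2_measurable[OF that(1)] L2_measurable[OF that(2)]
    show "(\<lambda>y. ?p y *\<^sub>R \<psi> y) \<in> borel_measurable lborel" "(\<lambda>y. ?p y *\<^sub>R u y) \<in> borel_measurable lborel"
      by measurable
    show "AE y in lborel. ?p y *\<^sub>R \<psi> y = ?p y *\<^sub>R u y" using u by eventually_elim simp
  qed
  show ?thesis
  proof (intro iffI conjI)
    assume D: "D_A_eps m A v \<epsilon> \<psi> \<phi>"
    then show \<psi>: "L2 \<psi>" and \<phi>: "L2 \<phi>" by (simp_all add: D_A_eps_def)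
    from D obtain u g where u: "AE x in lborel. \<psi> x = u x" and g: "L2 g"
      and H: "\<And>a b. a \<le> b \<Longrightarrow> (g has_integral (u b - u a)) {a..b}"
      and e: "AE x in lborel. \<phi> x = dirac_expr m u g x + ?p x *\<^sub>R (A *v (LINT y|lborel. ?p y *\<^sub>R \<psi> y))"
      unfolding D_A_eps_def by blast
    have "u \<in> borel_measurable borel"
      by (rule borel_measurable_broken[OF g, of u "u 0" "u 0"]) (use H in auto)
    then have u2: "L2 u" by (rule L2_cong_AE[OF \<psi> _ u])
    have "AE x in lborel. \<phi> x - z *s \<psi> x
        = - jmap (g x) + kmap m z (u x) + ?p x *\<^sub>R (A *v (LINT y|lborel. ?p y *\<^sub>R u y))"
      using u e unfolding I[OF \<psi> u2 u]
    proof eventually_elim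
      case (elim x)
      then show ?case unfolding dirac_expr_eq[symmetric] by simp
    qed
    then have "dom_E m A z ?p u g (\<lambda>x. \<phi> x - z *s \<psi> x)"
      using g H u2 \<psi> \<phi> by (simp add: dom_E_def is_H1_def L2_diff(1) L2_smult)
    then show "\<exists>u g. (AE x in lborel. \<psi> x = u x) \<and> dom_E m A z ?p u g (\<lambda>x. \<phi> x - z *s \<psi> x)"
      using u by blast
  next
    assume "L2 \<psi> \<and> L2 \<phi> \<and> (\<exists>u g. (AE x in lborel. \<psi> x = u x) \<and> dom_E m A z ?p u g (\<lambda>x. \<phi> x - z *s \<psi> x))"
    then obtain u g where h: "L2 \<psi>" "L2 \<phi>" and u: "AE x in lborel. \<psi> x = u x"
      and d: "dom_E m A z ?p u g (\<lambda>x. \<phi> x - z *s \<psi> x)" by blast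
    have H: "L2 u" "L2 g" "\<forall>a b. a \<le> b \<longrightarrow> (g has_integral (u b - u a)) {a..b}"
      using d by (auto simp: dom_E_def is_H1_def)
    have "AE x in lborel. \<phi> x - z *s \<psi> x
        = - jmap (g x) + kmap m z (u x) + ?p x *\<^sub>R (A *v (LINT y|lborel. ?p y *\<^sub>R u y))"
      using d by (simp add: dom_E_def)
    with u have "AE x in lborel. \<phi> x = dirac_expr m u g x + ?p x *\<^sub>R (A *v (LINT y|lborel. ?p y *\<^sub>R \<psi> y))"
      unfolding I[OF h(1) H(1) u]
    proof eventually_elim
      case (elim x)
      have "\<phi> x - z *s u x = (dirac_expr m u g x - z *s u x)
          + ?p x *\<^sub>R (A *v (LINT y|lborel. ?p y *\<^sub>R u y))"
        unfolding dirac_expr_eq using elim by simp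
      then show ?case by (simp add: algebra_simps)
    qed
    with h u H show "D_A_eps m A v \<epsilon> \<psi> \<phi>" unfolding D_A_eps_def by blast
  qed
qed

text \<open>The bound on \<open>R\<close> transfers to arbitrary solutions because \<open>R\<close>,
  as a left inverse, recovers each solution from its right-hand side.\<close>

lemma resolvent_D_A:
  assumes R: "is_resolvent (D_A m A) z R"
  obtains C where "0 \<le> C" "\<And>u g l r f. dom_A m A z u g l r f \<Longrightarrow> l2norm u \<le> C * l2norm f"
    "\<And>f. L2 f \<Longrightarrow> L2 (R f) \<and> (\<exists>u g l r. dom_A m A z u g l r f \<and> (AE x in lborel. R f x = u x))"
proof -
  obtain C0 where C0: "\<And>f. L2 f \<Longrightarrow> l2norm (R f) \<le> C0 * l2norm f"
    using R unfolding is_resolvent_def by blast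
  have sol: "L2 (R f) \<and> (\<exists>u g l r. dom_A m A z u g l r f \<and> (AE x in lborel. R f x = u x))" if "L2 f" for f
  proof -
    have "L2 (R f)" "D_A m A (R f) (\<lambda>x. f x + z *s R f x)"
      using R that by (auto simp: is_resolvent_def)
    then show ?thesis unfolding D_A_iff[where z = z] by auto
  qed
  \<comment> \<open>The constant supplied by \<open>is_resolvent\<close> carries no sign condition,
    hence the maximum with 0.\<close>
  have "l2norm u \<le> max 0 C0 * l2norm f" if d: "dom_A m A z u g l r f" for u g l r f
  proof -
    have u: "L2 u" and f: "L2 f" using d by (simp_all add: dom_A_def broken_H1_def)
    have "D_A m A u (\<lambda>x. f x + z *s u x)"
      unfolding D_A_iff[where z = z] using u f d by (auto intro: L2_add(1) L2_smult)
    then have "AE x in lborel. R (\<lambda>x. (f x + z *s u x) - z *s u x) x = u x"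
      using R unfolding is_resolvent_def by blast
    then have "AE x in lborel. R f x = u x" by simp
    then have "l2norm u = l2norm (R f)"
      using l2norm_cong_AE[of "R f" u] sol[OF f] u L2_measurable by auto
    also have "\<dots> \<le> C0 * l2norm f" by (rule C0[OF f])
    also have "\<dots> \<le> max 0 C0 * l2norm f" by (rule mult_right_mono) auto
    finally show ?thesis .
  qed
  then show thesis using that[of "max 0 C0"] sol by auto
qed

section \<open>The resolvent of the regularised operator\<close>

context dirac_approx
begin

lemma dom_E_diff:
  assumes E: "dom_E m A z p u g f" "dom_E m A z p u' g' f'"
  shows "dom_E m A z p (\<lambda>x. u x - u' x) (\<lambda>x. g x - g' x) (\<lambda>x. f x - f' x)"
proof -
  have L: "L2 u" "L2 g" "L2 f" "L2 u'" "L2 g'" "L2 f'" using E by (simp_all add: dom_E_def is_H1_def)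
  have I: "(LINT y|lborel. p y *\<^sub>R (u y - u' y)) = (LINT y|lborel. p y *\<^sub>R u y) - (LINT y|lborel. p y *\<^sub>R u' y)"
    using scalar_L2_integrable[OF p_measurable p_sq_integrable L(1)]
      scalar_L2_integrable[OF p_measurable p_sq_integrable L(4)]
    by (simp add: scaleR_diff_right)
  have "((\<lambda>x. g x - g' x) has_integral ((u b - u' b) - (u a - u' a))) {a..b}" if "a \<le> b" for a b
    using has_integral_diff[of g "u b - u a" "{a..b}" g' "u' b - u' a"] E that
    by (simp add: dom_E_def is_H1_def algebra_simps)
  moreover have "AE x in lborel. f x = - jmap (g x) + kmap m z (u x) + p x *\<^sub>R (A *v (LINT y|lborel. p y *\<^sub>R u y))"
    "AE x in lborel. f' x = - jmap (g' x) + kmap m z (u' x) + p x *\<^sub>R (A *v (LINT y|lborel. p y *\<^sub>R u' y))"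
    using E by (simp_all add: dom_E_def)
  then have "AE x in lborel. f x - f' x = - jmap (g x - g' x) + kmap m z (u x - u' x)
      + p x *\<^sub>R (A *v (LINT y|lborel. p y *\<^sub>R (u y - u' y)))"
    unfolding I by eventually_elim (simp add: jmap_simps kmap_simps mat_simps scaleR_diff_right)
  ultimately show ?thesis using L by (simp add: dom_E_def is_H1_def L2_diff(1))
qed

lemma dom_E_unique:
  assumes "dom_E m A z p u g f" "dom_E m A z p u' g' f" and small: "rate \<le> 1"
  shows "AE x in lborel. u x = u' x"
proof -
  have E: "dom_E m A z p (\<lambda>x. u x - u' x) (\<lambda>x. g x - g' x) (\<lambda>x. 0)"
    using dom_E_diff[OF assms(1,2)] by simp
  have "l2norm (\<lambda>x. u x - u' x) \<le> 0" using resolvent_difference[OF E dom_A_zero small] by simp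
  then have "AE x in lborel. u x - u' x = 0"
    by (rule l2norm_eq_0_AE[rotated]) (use E in \<open>simp add: dom_E_def is_H1_def\<close>)
  then show ?thesis by simp
qed

lemma resolvent_set_D_A_eps:
  assumes p: "p = v_eps v \<epsilon>" and small: "rate \<le> 1"
  shows "resolvent_set_mem (D_A_eps m A v \<epsilon>) z"
proof -
  note iff = D_A_eps_iff[OF p_measurable[unfolded p], where z = z, folded p]
  \<comment> \<open>Any choice of solution works: uniqueness up to null sets makes the chosen map a
    left inverse, and no linearity has to be shown.\<close>
  define R where "R f = (if L2 f then SOME u. \<exists>g. dom_E m A z p u g f else (\<lambda>x. 0))" for f
  have R: "\<exists>g. dom_E m A z p (R f) g f" if "L2 f" for f
    using someI_ex[OF dom_E_solvable[OF that small]] that by (simp add: R_def)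
  then have RL: "L2 (R f)" if "L2 f" for f using that by (auto simp: dom_E_def is_H1_def)
  have "is_resolvent (D_A_eps m A v \<epsilon>) z R"
    unfolding is_resolvent_def
  proof (intro conjI allI impI)
    fix f :: cfun assume f: "L2 f"
    show "L2 (R f)" by (rule RL[OF f])
    have "dom_E m A z p (R f) g (\<lambda>x. (f x + z *s R f x) - z *s R f x)" if "dom_E m A z p (R f) g f" for g
      using that by simp
    then show "D_A_eps m A v \<epsilon> (R f) (\<lambda>x. f x + z *s R f x)"
      unfolding iff using R[OF f] RL[OF f] f by (auto intro: L2_add(1) L2_smult)
  next
    fix \<psi> \<phi> assume "D_A_eps m A v \<epsilon> \<psi> \<phi>"
    then obtain u g where u: "AE x in lborel. \<psi> x = u x" and E: "dom_E m A z p u g (\<lambda>x. \<phi> x - z *s \<psi> x)"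
      unfolding iff by blast
    then obtain g' where "dom_E m A z p (R (\<lambda>x. \<phi> x - z *s \<psi> x)) g' (\<lambda>x. \<phi> x - z *s \<psi> x)"
      using R[of "\<lambda>x. \<phi> x - z *s \<psi> x"] by (auto simp: dom_E_def)
    from dom_E_unique[OF this E small] u
    show "AE x in lborel. R (\<lambda>x. \<phi> x - z *s \<psi> x) x = \<psi> x" by eventually_elim simp
  next
    have "l2norm (R f) \<le> (rate + C) * l2norm f" if f: "L2 f" for f
    proof -
      obtain g where E: "dom_E m A z p (R f) g f" using R[OF f] by blast
      obtain u1 g1 l1 r1 where D: "dom_A m A z u1 g1 l1 r1 f" using solvable[OF f] by blast
      then have u1: "L2 u1" by (simp add: dom_A_def broken_H1_def)
      have "l2norm (R f) \<le> l2norm (\<lambda>x. R f x - u1 x) + l2norm u1"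
        using L2_add(2)[OF L2_diff(1)[OF RL[OF f] u1] u1] by simp
      then show ?thesis
        using resolvent_difference[OF E D small] stable[OF D] by (simp add: distrib_right)
    qed
    then show "\<exists>C. \<forall>f. L2 f \<longrightarrow> l2norm (R f) \<le> C * l2norm f" by blast
  qed
  then show ?thesis unfolding resolvent_set_mem_def by blast
qed

text \<open>The resolvents are arbitrary and determined only up to null sets, so both values are
  first replaced by honest solutions with the same right-hand side.\<close>

lemma resolvents_close:
  assumes p: "p = v_eps v \<epsilon>" and small: "rate \<le> 1"
    and R': "is_resolvent (D_A_eps m A v \<epsilon>) z R'" and R: "is_resolvent (D_A m A) z R" and f: "L2 f"
  shows "l2norm (\<lambda>x. R' f x - R f x) \<le> rate * l2norm f"
proof -
  have R'f: "L2 (R' f)" "D_A_eps m A v \<epsilon> (R' f) (\<lambda>x. f x + z *s R' f x)"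
    using R' f by (auto simp: is_resolvent_def)
  then obtain u g where u: "AE x in lborel. R' f x = u x" and E: "dom_E m A z p u g f"
    unfolding D_A_eps_iff[OF p_measurable[unfolded p], where z = z, folded p] by auto
  from resolvent_D_A[OF R] f obtain u1 g1 l1 r1 where Rf: "L2 (R f)"
    and D: "dom_A m A z u1 g1 l1 r1 f" and u1: "AE x in lborel. R f x = u1 x" by metis
  have L: "L2 u" "L2 u1" using E D by (simp_all add: dom_E_def is_H1_def dom_A_def broken_H1_def)
  have "l2norm (\<lambda>x. R' f x - R f x) = l2norm (\<lambda>x. u x - u1 x)"
  proof (rule l2norm_cong_AE)
    show "AE x in lborel. R' f x - R f x = u x - u1 x" using u u1 by eventually_elim simp
  qed (use L2_diff(1)[OF R'f(1) Rf] L2_diff(1)[OF L] in \<open>auto intro: L2_measurable\<close>)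
  then show ?thesis using resolvent_difference[OF E D small] by simp
qed

end

section \<open>Scaling of the profile and passage to the limit\<close>

lemma v_eps_integral:
  fixes h k :: "real \<Rightarrow> real"
  assumes "0 < \<epsilon>"
  shows "(LINT x|lborel. h (v (x / \<epsilon>)) / \<epsilon> * k x) = (LINT y|lborel. h (v y) * k (\<epsilon> * y))"
  using lborel_integral_real_affine[of \<epsilon> "\<lambda>x. h (v (x / \<epsilon>)) / \<epsilon> * k x" 0] assms by simp

lemma
  assumes v [measurable]: "v \<in> borel_measurable borel" and v1: "integrable lborel v"
    and v2: "integrable lborel (\<lambda>x. (v x)\<^sup>2)" and v3: "(LINT x|lborel. v x) = 1" and \<epsilon>: "0 < \<epsilon>"
  shows mollifier_v_eps: "mollifier (v_eps v \<epsilon>)"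
    and mass_v_eps: "mollifier.mass (v_eps v \<epsilon>) = (LINT x|lborel. \<bar>v x\<bar>)"
    and spread_v_eps: "mollifier.spread (v_eps v \<epsilon>) = (LINT x|lborel. \<bar>v x\<bar> * trunc_sqrt (\<epsilon> * x))"
proof -
  have aff: "integrable lborel (\<lambda>x. h (x / \<epsilon>))" if "integrable lborel h" for h :: "real \<Rightarrow> real"
    using lborel_integrable_real_affine[OF that, of "1 / \<epsilon>" 0] \<epsilon> by simp
  show M: "mollifier (v_eps v \<epsilon>)"
  proof
    show "v_eps v \<epsilon> \<in> borel_measurable borel" unfolding v_eps_def[abs_def] by measurable
    show "integrable lborel (v_eps v \<epsilon>)" unfolding v_eps_def[abs_def] using aff[OF v1] by simp
    show "integrable lborel (\<lambda>x. (v_eps v \<epsilon> x)\<^sup>2)"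
      unfolding v_eps_def[abs_def] power_divide using aff[OF v2] by simp
    show "integral\<^sup>L lborel (v_eps v \<epsilon>) = 1"
      unfolding v_eps_def[abs_def] using v_eps_integral[OF \<epsilon>, of "\<lambda>x. x" v "\<lambda>x. 1"] v3 by simp
  qed
  have abs: "\<bar>v_eps v \<epsilon> x\<bar> = \<bar>v (x / \<epsilon>)\<bar> / \<epsilon>" for x using \<epsilon> by (simp add: v_eps_def)
  show "mollifier.mass (v_eps v \<epsilon>) = (LINT x|lborel. \<bar>v x\<bar>)"
    unfolding mollifier.mass_def[OF M] abs using v_eps_integral[OF \<epsilon>, of abs v "\<lambda>x. 1"] by simp
  show "mollifier.spread (v_eps v \<epsilon>) = (LINT x|lborel. \<bar>v x\<bar> * trunc_sqrt (\<epsilon> * x))"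
    unfolding mollifier.spread_def[OF M] abs using v_eps_integral[OF \<epsilon>, of abs v trunc_sqrt] by simp
qed

text \<open>Dominated convergence with dominating function |v|, in the variable
  \<open>t = 1 / \<epsilon>\<close>.\<close>

lemma spread_tendsto_0:
  assumes [measurable]: "v \<in> borel_measurable borel" and v: "integrable lborel v"
  shows "((\<lambda>t. LINT x|lborel. \<bar>v x\<bar> * trunc_sqrt (x / t)) \<longlongrightarrow> 0) at_top"
proof -
  have "((\<lambda>t. LINT x|lborel. \<bar>v x\<bar> * trunc_sqrt (x / t)) \<longlongrightarrow> (LINT x|(lborel :: real measure). (0::real))) at_top"
  proof (rule integral_dominated_convergence_at_top[where w = "\<lambda>x. \<bar>v x\<bar>"])
    show "AE x in lborel. ((\<lambda>t. \<bar>v x\<bar> * trunc_sqrt (x / t)) \<longlongrightarrow> 0) at_top"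
    proof (rule AE_I2)
      fix x :: real
      have "((\<lambda>t. x / t) \<longlongrightarrow> 0) at_top"
        by (rule real_tendsto_divide_at_top[OF tendsto_const filterlim_ident])
      then have "((\<lambda>t. \<bar>v x\<bar> * min 1 (sqrt \<bar>x / t\<bar>)) \<longlongrightarrow> \<bar>v x\<bar> * min 1 (sqrt \<bar>0\<bar>)) at_top"
        by (intro tendsto_intros)
      then show "((\<lambda>t. \<bar>v x\<bar> * trunc_sqrt (x / t)) \<longlongrightarrow> 0) at_top" by (simp add: trunc_sqrt_def)
    qed
    show "\<forall>\<^sub>F t in at_top. AE x in lborel. norm (\<bar>v x\<bar> * trunc_sqrt (x / t)) \<le> \<bar>v x\<bar>"
      by (intro always_eventually allI AE_I2) (simp add: abs_mult mult_left_le)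
  qed (use v in auto)
  then show ?thesis by simp
qed

theorem theorem4p1:
  fixes m :: real and A :: "complex ^ 2 ^ 2" and v :: "real \<Rightarrow> real" and z :: complex
  assumes "v \<in> borel_measurable lborel"
    and "integrable lborel v"
    and "integrable lborel (\<lambda>x. (v x)\<^sup>2)"
    and "(LINT x|lborel. v x) = 1"
    and "resolvent_set_mem (D_A m A) z"
  shows "(\<exists>\<epsilon>0>0. \<forall>\<epsilon>. 0 < \<epsilon> \<and> \<epsilon> < \<epsilon>0 \<longrightarrow> resolvent_set_mem (D_A_eps m A v \<epsilon>) z) \<and>
         (\<forall>e>0. \<exists>\<delta>>0. \<forall>\<epsilon> R\<epsilon> R. 0 < \<epsilon> \<and> \<epsilon> < \<delta> \<and>
              is_resolvent (D_A_eps m A v \<epsilon>) z R\<epsilon> \<and> is_resolvent (D_A m A) z R \<longrightarrow>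
              l2_opnorm_le (\<lambda>f x. R\<epsilon> f x - R f x) e)"
proof -
  have v: "v \<in> borel_measurable borel" using assms(1) by simp
  \<comment> \<open>This resolvent serves only to fix \<open>C\<close>; neither the resolvents
    compared later nor \<epsilon> enter the constants.\<close>
  obtain R0 where "is_resolvent (D_A m A) z R0" using assms(5) unfolding resolvent_set_mem_def by blast
  from resolvent_D_A[OF this] obtain C where C: "0 \<le> C"
    "\<And>u g l r f. dom_A m A z u g l r f \<Longrightarrow> l2norm u \<le> C * l2norm f"
    "\<And>f. L2 f \<Longrightarrow> \<exists>u g l r. dom_A m A z u g l r f" by metis
  obtain a where a: "0 \<le> a" "\<And>y. norm (A *v y) \<le> a * norm y"
    using bounded_linear.nonneg_bounded[OF bounded_linear_mat[of A]] by (auto simp: mult.commute)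
  define V where "V = (LINT x|lborel. \<bar>v x\<bar>)"
  define K where "K = approx_const (\<bar>m\<bar> + cmod z) C a V"
  define \<rho> where "\<rho> \<epsilon> = K * sqrt (LINT x|lborel. \<bar>v x\<bar> * trunc_sqrt (\<epsilon> * x))" for \<epsilon>
  have approx: "dirac_approx (v_eps v \<epsilon>) m A z C a" if "0 < \<epsilon>" for \<epsilon>
    using mollifier_v_eps[OF v assms(2-4) that] a C
    by (simp add: dirac_approx_def dirac_approx_axioms_def)
  have rate: "dirac_approx.rate (v_eps v \<epsilon>) m z C a = \<rho> \<epsilon>" if "0 < \<epsilon>" for \<epsilon>
    unfolding dirac_approx.rate_def[OF approx[OF that]]
    by (simp add: mass_v_eps[OF v assms(2-4) that] spread_v_eps[OF v assms(2-4) that] \<rho>_def K_def V_def)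
  have small: "\<exists>\<delta>>0. \<forall>\<epsilon>. 0 < \<epsilon> \<and> \<epsilon> < \<delta> \<longrightarrow> \<rho> \<epsilon> \<le> e" if "0 < e" for e
  proof -
    have "((\<lambda>t. K * sqrt (LINT x|lborel. \<bar>v x\<bar> * trunc_sqrt (x / t))) \<longlongrightarrow> K * sqrt 0) at_top"
      by (intro tendsto_intros spread_tendsto_0 v assms(2))
    then have "\<forall>\<^sub>F t in at_top. K * sqrt (LINT x|lborel. \<bar>v x\<bar> * trunc_sqrt (x / t)) < e"
      using that by (intro order_tendstoD) auto
    then obtain T where T: "\<And>t. T \<le> t \<Longrightarrow> K * sqrt (LINT x|lborel. \<bar>v x\<bar> * trunc_sqrt (x / t)) < e"
      by (auto simp: eventually_at_top_linorder)
    \<comment> \<open>The maximum keeps the threshold well defined and positive even if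
      \<open>T\<close> is not.\<close>
    have "\<rho> \<epsilon> \<le> e" if "0 < \<epsilon>" "\<epsilon> < 1 / max 1 T" for \<epsilon>
    proof -
      have "max 1 T * \<epsilon> < 1" using that by (simp add: field_simps)
      then have "max 1 T \<le> 1 / \<epsilon>" using that by (subst pos_le_divide_eq) simp_all
      then have "T \<le> 1 / \<epsilon>" by simp
      from T[OF this] show ?thesis by (simp add: \<rho>_def mult.commute)
    qed
    moreover have "0 < 1 / max 1 T" by simp
    ultimately show ?thesis by blast
  qed
  show ?thesis
  proof (intro conjI allI impI)
    obtain \<delta> where \<delta>: "0 < \<delta>" "\<And>\<epsilon>. 0 < \<epsilon> \<and> \<epsilon> < \<delta> \<Longrightarrow> \<rho> \<epsilon> \<le> 1" using small[of 1] by auto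
    have "resolvent_set_mem (D_A_eps m A v \<epsilon>) z" if "0 < \<epsilon>" "\<epsilon> < \<delta>" for \<epsilon>
      using dirac_approx.resolvent_set_D_A_eps[OF approx[OF that(1)] refl] \<delta>(2) that
      by (simp add: rate[OF that(1)])
    then show "\<exists>\<epsilon>0>0. \<forall>\<epsilon>. 0 < \<epsilon> \<and> \<epsilon> < \<epsilon>0 \<longrightarrow> resolvent_set_mem (D_A_eps m A v \<epsilon>) z"
      using \<delta>(1) by blast
  next
    fix e :: real assume e: "0 < e"
    \<comment> \<open>The estimate itself requires a rate of at most 1, hence the minimum with
      \<open>e\<close>.\<close>
    obtain \<delta> where \<delta>: "0 < \<delta>" "\<And>\<epsilon>. 0 < \<epsilon> \<and> \<epsilon> < \<delta> \<Longrightarrow> \<rho> \<epsilon> \<le> min 1 e" using small[of "min 1 e"] e by auto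
    have "l2_opnorm_le (\<lambda>f x. R\<epsilon> f x - R f x) e"
      if h: "0 < \<epsilon>" "\<epsilon> < \<delta>" "is_resolvent (D_A_eps m A v \<epsilon>) z R\<epsilon>" "is_resolvent (D_A m A) z R" for \<epsilon> R\<epsilon> R
      unfolding l2_opnorm_le_def
    proof (intro allI impI)
      fix f :: cfun assume f: "L2 f"
      have \<rho>: "\<rho> \<epsilon> \<le> 1" "\<rho> \<epsilon> \<le> e" using \<delta>(2)[of \<epsilon>] h by auto
      have "l2norm (\<lambda>x. R\<epsilon> f x - R f x) \<le> \<rho> \<epsilon> * l2norm f"
        using dirac_approx.resolvents_close[OF approx[OF h(1)] refl _ h(3,4) f] \<rho>(1)
        by (simp add: rate[OF h(1)])
      also have "\<dots> \<le> e * l2norm f" by (rule mult_right_mono[OF \<rho>(2)]) simp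
      finally show "l2norm (\<lambda>x. R\<epsilon> f x - R f x) \<le> e * l2norm f" .
    qed
    then show "\<exists>\<delta>>0. \<forall>\<epsilon> R\<epsilon> R. 0 < \<epsilon> \<and> \<epsilon> < \<delta> \<and>
              is_resolvent (D_A_eps m A v \<epsilon>) z R\<epsilon> \<and> is_resolvent (D_A m A) z R \<longrightarrow>
              l2_opnorm_le (\<lambda>f x. R\<epsilon> f x - R f x) e"
      using \<delta>(1) by blast
  qed
qed

end
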